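(* Let $k\in\mathbb{T}$. The following statements are equivalent. (i) The convexity condition $\inf_{\bar u_k\in L^2_{\mathcal F}(k;\mathbb{R}^m)}\widehat J(k,0;\bar u_k)\ge0$ is satisfied (that is, $\widehat J(k,0;\bar u_k)\ge 0$ almost surely for every $\bar u_k\in L^2_{\mathcal F}(k;\mathbb{R}^m)$). (ii) The following inequality holds: $$\mathcal R_{k,k}+\mathcal B_{k,k}^T\mathcal P_{k,k+1}\mathcal B_{k,k}+\mathcal D_{k,k}^TP_{k,k+1}\mathcal D_{k,k}\ge0,$$ where $P_{k,k+1}$ and $\mathcal P_{k,k+1}$ are computed via $$\begin{cases}P_{k,\ell}=Q_{k,\ell}+A_{k,\ell}^TP_{k,\ell+1}A_{k,\ell}+C_{k,\ell}^TP_{k,\ell+1}C_{k,\ell},\\ \mathcal P_{k,\ell}=\mathcal Q_{k,\ell}+\mathcal A_{k,\ell}^T\mathcal P_{k,\ell+1}\mathcal A_{k,\ell}+\mathcal C_{k,\ell}^TP_{k,\ell+1}\mathcal C_{k,\ell},\\ P_{k,N}=G_k,\quad\mathcal P_{k,N}=\mathcal G_k,\quad\ell\in\mathbb{T}_k.\end{cases}$$ (iii) Problem (LQ) is point-wisely convex at $(k,\zeta)$ for some $\zeta\in L^2_{\mathcal F}(k;\mathbb{R}^n)$. (iv) Problem (LQ) is point-wisely convex at $(k,\zeta)$ for any $\zeta\in L^2_{\mathcal F}(k;\mathbb{R}^n)$. Furthermore, if Problem (LQ) admits an open-loop equilibrium pair for the initial pair $(t,x)$ (with $t\in\mathbb{T}$,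 $x\in L^2_{\mathcal F}(t;\mathbb{R}^n)$), then for any $k\in\mathbb{T}_t$ and any $\zeta\in L^2_{\mathcal F}(k;\mathbb{R}^n)$, Problem (LQ) is point-wisely convex at $(k,\zeta)$.
   Context: **Setting.** $N,n,m$ are positive integers; $\mathbb{T}=\{0,\dots,N-1\}$, $\mathbb{T}_t=\{t,\dots,N-1\}$ (empty for $t=N$). $\{w_k,k\in\mathbb{T}\}$ is a real martingale difference sequence on a probability space $(\Omega,\mathcal F,P)$; $\mathcal F_k=\sigma\{w_0,\dots,w_{k-1}\}$, $\mathcal F_0=\{\emptyset,\Omega\}$, $\mathbb{E}_k=\mathbb{E}[\,\cdot\,|\mathcal F_k]$, and $\mathbb{E}_k[w_k]=0$, $\mathbb{E}_k[w_k^2]=1$ for $k\in\mathbb{T}$. $L^2_{\mathcal F}(k;\mathcal H)$ is the set of $\mathcal F_k$-measurable square-integrable $\mathcal H$-valued random variables; $L^2_{\mathcal F}(\mathbb{T}_t;\mathcal H)$ is the set of processes $\nu=\{\nu_k,k\in\mathbb{T}_t\}$ with $\nu_k$ $\mathcal F_k$-measurable and $\sum_{k=t}^{N-1}\mathbb{E}|\nu_k|^2<\infty$. Relations between random variables hold almost surely. For $t\in\mathbb{T}$, $k\in\mathbb{T}_t$ the following deterministic data are given: $A_{t,k},\bar A_{t,k},C_{t,k},\bar C_{t,k}\in\mathbb{R}^{n\times n}$; $B_{t,k},\bar B_{t,k},D_{t,k},\bar D_{t,k}\in\mathbb{R}^{n\times m}$; $f_{t,k},d_{t,k},q_{t,k},g_t\in\mathbb{R}^n$;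 $\rho_{t,k}\in\mathbb{R}^m$; symmetric $Q_{t,k},\bar Q_{t,k},G_t,\bar G_t\in\mathbb{R}^{n\times n}$ and $R_{t,k},\bar R_{t,k}\in\mathbb{R}^{m\times m}$ (no definiteness assumed). Calligraphic letters denote sums: $\mathcal A_{k,\ell}=A_{k,\ell}+\bar A_{k,\ell}$, and likewise $\mathcal B,\mathcal C,\mathcal D,\mathcal Q,\mathcal R$; $\mathcal G_k=G_k+\bar G_k$. For $t\in\mathbb{T}$, $x\in L^2_{\mathcal F}(t;\mathbb{R}^n)$, $u\in L^2_{\mathcal F}(\mathbb{T}_t;\mathbb{R}^m)$, the state $X^t$ solves, for $k\in\mathbb{T}_t$, $X^t_t=x$ and $$X^t_{k+1}=\big(A_{t,k}X^t_k+\bar A_{t,k}\mathbb{E}_tX^t_k+B_{t,k}u_k+\bar B_{t,k}\mathbb{E}_tu_k+f_{t,k}\big)+\big(C_{t,k}X^t_k+\bar C_{t,k}\mathbb{E}_tX^t_k+D_{t,k}u_k+\bar D_{t,k}\mathbb{E}_tu_k+d_{t,k}\big)w_k,$$ and the cost is $$J(t,x;u)=\sum_{k=t}^{N-1}\mathbb{E}_t\big\{(X^t_k)^TQ_{t,k}X^t_k+(\mathbb{E}_tX^t_k)^T\bar Q_{t,k}\mathbb{E}_tX^t_k+u_k^TR_{t,k}u_k+(\mathbb{E}_tu_k)^T\bar R_{t,k}\mathbb{E}_tu_k+2q_{t,k}^TX^t_k+2\rho_{t,k}^Tu_k\big\}$$ $$+\mathbb{E}_t[(X^t_N)^TG_tX^t_N]+(\mathbb{E}_tX^t_N)^T\bar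 G_t\mathbb{E}_tX^t_N+2\mathbb{E}_t[g_t^TX^t_N].$$ Problem (LQ) is the (time-inconsistent) problem of minimizing $J(t,x;\cdot)$ over $L^2_{\mathcal F}(\mathbb{T}_t;\mathbb{R}^m)$. **Point-wise convexity.** Problem (LQ) is point-wisely convex at $(k,\zeta)$, $\zeta\in L^2_{\mathcal F}(k;\mathbb{R}^n)$, if for any fixed $u|_{\mathbb{T}_{k+1}}\in L^2_{\mathcal F}(\mathbb{T}_{k+1};\mathbb{R}^m)$ the map $\bar u_k\mapsto J(k,\zeta;(\bar u_k,u|_{\mathbb{T}_{k+1}}))$ is convex in $\bar u_k\in L^2_{\mathcal F}(k;\mathbb{R}^m)$ (the values being $\mathcal F_k$-measurable random variables). **Open-loop equilibrium pair.** A pair $(X^{t,x,*},u^{t,x,*})$ with $u^{t,x,*}\in L^2_{\mathcal F}(\mathbb{T}_t;\mathbb{R}^m)$, whose state satisfies $X^{t,x,*}_t=x$ and, for $k\in\mathbb{T}_t$, $$X^{t,x,*}_{k+1}=[\mathcal A_{k,k}X^{t,x,*}_k+\mathcal B_{k,k}u^{t,x,*}_k+f_{k,k}]+[\mathcal C_{k,k}X^{t,x,*}_k+\mathcal D_{k,k}u^{t,x,*}_k+d_{k,k}]w_k,$$ is an open-loop equilibrium pair of Problem (LQ) for $(t,x)$ if for every $k\in\mathbb{T}_t$ and every $u_k\in L^2_{\mathcal F}(k;\mathbb{R}^m)$, $$J(k,X^{t,x,*}_k;u^{t,x,*}|_{\mathbb{T}_k})\le J(k,X^{t,x,*}_k;(u_k,u^{t,x,*}|_{\mathbb{T}_{k+1}})),$$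 where $|_{\mathbb{T}_k}$ denotes restriction to $\mathbb{T}_k$. **The functional $\widehat J$.** For $k\in\mathbb{T}$, $\bar u_k\in L^2_{\mathcal F}(k;\mathbb{R}^m)$, let $Y^{k,\bar u_k}$ be defined by $Y^{k,\bar u_k}_k=0$, $Y^{k,\bar u_k}_{k+1}=\mathcal B_{k,k}\bar u_k+\mathcal D_{k,k}\bar u_kw_k$, and for $\ell\in\mathbb{T}_{k+1}$, $Y^{k,\bar u_k}_{\ell+1}=A_{k,\ell}Y^{k,\bar u_k}_\ell+\bar A_{k,\ell}\mathbb{E}_kY^{k,\bar u_k}_\ell+(C_{k,\ell}Y^{k,\bar u_k}_\ell+\bar C_{k,\ell}\mathbb{E}_kY^{k,\bar u_k}_\ell)w_\ell$. Then $$\widehat J(k,0;\bar u_k)=\sum_{\ell=k}^{N-1}\mathbb{E}_k\big[(Y^{k,\bar u_k}_\ell)^TQ_{k,\ell}Y^{k,\bar u_k}_\ell+(\mathbb{E}_kY^{k,\bar u_k}_\ell)^T\bar Q_{k,\ell}\mathbb{E}_kY^{k,\bar u_k}_\ell\big]+\bar u_k^T\mathcal R_{k,k}\bar u_k$$ $$+\mathbb{E}_k[(Y^{k,\bar u_k}_N)^TG_kY^{k,\bar u_k}_N]+(\mathbb{E}_kY^{k,\bar u_k}_N)^T\bar G_k\mathbb{E}_kY^{k,\bar u_k}_N.$$ *)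

theory Defs
  imports "HOL-Probability.Probability"
begin

definition filt :: "'a measure \<Rightarrow> (nat \<Rightarrow> 'a \<Rightarrow> real) \<Rightarrow> nat \<Rightarrow> 'a measure" where
  "filt M w k = sigma (space M) {w i -` S \<inter> space M | i S. i < k \<and> S \<in> sets borel}"

abbreviation cond_real ::
    "'a measure \<Rightarrow> (nat \<Rightarrow> 'a \<Rightarrow> real) \<Rightarrow> nat \<Rightarrow> ('a \<Rightarrow> real) \<Rightarrow> 'a \<Rightarrow> real" where
  "cond_real M w k \<equiv> real_cond_exp M (filt M w k)"

text \<open>The library only has real-valued conditional expectations; vectors are treated componentwise.\<close>

definition cond_vec ::
    "'a measure \<Rightarrow> (nat \<Rightarrow> 'a \<Rightarrow> real) \<Rightarrow> nat \<Rightarrow> ('a \<Rightarrow> real ^ 'd) \<Rightarrow> 'a \<Rightarrow> real ^ 'd" where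
  "cond_vec M w k X = (\<lambda>\<omega>. \<chi> i. cond_real M w k (\<lambda>\<omega>'. X \<omega>' $ i) \<omega>)"

text \<open>The time set is \<open>{0..<N}\<close>; only \<open>w k\<close> with \<open>k < N\<close> is ever used. Adaptedness of \<open>w k\<close> to
  \<open>filt M w (Suc k)\<close> is automatic.\<close>

locale mds_noise = prob_space M
  for M :: "'a measure" +
  fixes w :: "nat \<Rightarrow> 'a \<Rightarrow> real" and N :: nat
  assumes w_measurable: "k < N \<Longrightarrow> w k \<in> borel_measurable M"
    and w_integrable: "k < N \<Longrightarrow> integrable M (w k)"
    and w_sq_integrable: "k < N \<Longrightarrow> integrable M (\<lambda>\<omega>. (w k \<omega>)\<^sup>2)"
    and w_mean: "k < N \<Longrightarrow> AE \<omega> in M. cond_real M w k (w k) \<omega> = 0"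
    and w_variance: "k < N \<Longrightarrow> AE \<omega> in M. cond_real M w k (\<lambda>\<omega>. (w k \<omega>)\<^sup>2) \<omega> = 1"

definition L2F :: "'a measure \<Rightarrow> (nat \<Rightarrow> 'a \<Rightarrow> real) \<Rightarrow> nat \<Rightarrow> ('a \<Rightarrow> real ^ 'd) set" where
  "L2F M w k = {X. X \<in> borel_measurable (filt M w k) \<and> integrable M (\<lambda>\<omega>. (norm (X \<omega>))\<^sup>2)}"

text \<open>Processes indexed by \<open>{t..<N}\<close>; values at other times are irrelevant. The finite sum of second
  moments is finite iff every summand is.\<close>

definition L2F_proc ::
    "'a measure \<Rightarrow> (nat \<Rightarrow> 'a \<Rightarrow> real) \<Rightarrow> nat \<Rightarrow> nat \<Rightarrow> (nat \<Rightarrow> 'a \<Rightarrow> real ^ 'd) set" where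
  "L2F_proc M w N t = {u. \<forall>k\<in>{t..<N}. u k \<in> L2F M w k}"

text \<open>The first index is the initial time, the second one the running time.
  A matrix with \<open>n\<close> rows and \<open>m\<close> columns has type \<open>real ^ 'm ^ 'n\<close>.\<close>

record ('n::finite, 'm::finite) lq_data =
  mA :: "nat \<Rightarrow> nat \<Rightarrow> real ^ 'n ^ 'n"
  mA_bar :: "nat \<Rightarrow> nat \<Rightarrow> real ^ 'n ^ 'n"
  mB :: "nat \<Rightarrow> nat \<Rightarrow> real ^ 'm ^ 'n"
  mB_bar :: "nat \<Rightarrow> nat \<Rightarrow> real ^ 'm ^ 'n"
  mC :: "nat \<Rightarrow> nat \<Rightarrow> real ^ 'n ^ 'n"
  mC_bar :: "nat \<Rightarrow> nat \<Rightarrow> real ^ 'n ^ 'n"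
  mD :: "nat \<Rightarrow> nat \<Rightarrow> real ^ 'm ^ 'n"
  mD_bar :: "nat \<Rightarrow> nat \<Rightarrow> real ^ 'm ^ 'n"
  vf :: "nat \<Rightarrow> nat \<Rightarrow> real ^ 'n"
  vd :: "nat \<Rightarrow> nat \<Rightarrow> real ^ 'n"
  mQ :: "nat \<Rightarrow> nat \<Rightarrow> real ^ 'n ^ 'n"
  mQ_bar :: "nat \<Rightarrow> nat \<Rightarrow> real ^ 'n ^ 'n"
  mR :: "nat \<Rightarrow> nat \<Rightarrow> real ^ 'm ^ 'm"
  mR_bar :: "nat \<Rightarrow> nat \<Rightarrow> real ^ 'm ^ 'm"
  vq :: "nat \<Rightarrow> nat \<Rightarrow> real ^ 'n"
  vrho :: "nat \<Rightarrow> nat \<Rightarrow> real ^ 'm"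
  mG :: "nat \<Rightarrow> real ^ 'n ^ 'n"
  mG_bar :: "nat \<Rightarrow> real ^ 'n ^ 'n"
  vg :: "nat \<Rightarrow> real ^ 'n"

definition symmetric_data :: "nat \<Rightarrow> ('n::finite, 'm::finite) lq_data \<Rightarrow> bool" where
  "symmetric_data N p \<longleftrightarrow>
     (\<forall>t<N. transpose (mG p t) = mG p t \<and> transpose (mG_bar p t) = mG_bar p t \<and>
       (\<forall>k\<in>{t..<N}.
         transpose (mQ p t k) = mQ p t k \<and> transpose (mQ_bar p t k) = mQ_bar p t k \<and>
         transpose (mR p t k) = mR p t k \<and> transpose (mR_bar p t k) = mR_bar p t k))"

abbreviation "calA p k l \<equiv> mA p k l + mA_bar p k l"
abbreviation "calB p k l \<equiv> mB p k l + mB_bar p k l"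
abbreviation "calC p k l \<equiv> mC p k l + mC_bar p k l"
abbreviation "calD p k l \<equiv> mD p k l + mD_bar p k l"
abbreviation "calQ p k l \<equiv> mQ p k l + mQ_bar p k l"
abbreviation "calR p k l \<equiv> mR p k l + mR_bar p k l"
abbreviation "calG p k \<equiv> mG p k + mG_bar p k"

abbreviation qform :: "real ^ 'd ^ 'd \<Rightarrow> real ^ 'd \<Rightarrow> real" where
  "qform S x \<equiv> x \<bullet> (S *v x)"

definition psd :: "real ^ 'd ^ 'd \<Rightarrow> bool" where
  "psd S \<longleftrightarrow> transpose S = S \<and> (\<forall>x. 0 \<le> qform S x)"

text \<open>State with initial time \<open>t\<close>; only the values at times \<open>\<ge> t\<close> are meaningful (before \<open>t\<close> the value is
  the dummy \<open>x\<close>). The recursion is pathwise for the version of the conditional expectation fixed by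
  the library; solutions built from other versions agree with it almost surely.\<close>

primrec state ::
    "'a measure \<Rightarrow> (nat \<Rightarrow> 'a \<Rightarrow> real) \<Rightarrow> ('n::finite, 'm::finite) lq_data \<Rightarrow> nat \<Rightarrow>
     ('a \<Rightarrow> real ^ 'n) \<Rightarrow> (nat \<Rightarrow> 'a \<Rightarrow> real ^ 'm) \<Rightarrow> nat \<Rightarrow> 'a \<Rightarrow> real ^ 'n" where
  "state M w p t x u 0 = x"
| "state M w p t x u (Suc k) =
     (if k < t then x else
      (let X = state M w p t x u k in (\<lambda>\<omega>.
        (mA p t k *v X \<omega> + mA_bar p t k *v cond_vec M w t X \<omega>
         + mB p t k *v u k \<omega> + mB_bar p t k *v cond_vec M w t (u k) \<omega> + vf p t k)
        + w k \<omega> *\<^sub>R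
        (mC p t k *v X \<omega> + mC_bar p t k *v cond_vec M w t X \<omega>
         + mD p t k *v u k \<omega> + mD_bar p t k *v cond_vec M w t (u k) \<omega> + vd p t k))))"

definition cost ::
    "'a measure \<Rightarrow> (nat \<Rightarrow> 'a \<Rightarrow> real) \<Rightarrow> nat \<Rightarrow> ('n::finite, 'm::finite) lq_data \<Rightarrow> nat \<Rightarrow>
     ('a \<Rightarrow> real ^ 'n) \<Rightarrow> (nat \<Rightarrow> 'a \<Rightarrow> real ^ 'm) \<Rightarrow> 'a \<Rightarrow> real" where
  "cost M w N p t x u = (let X = state M w p t x u in (\<lambda>\<omega>.
     (\<Sum>k=t..<N. cond_real M w t (\<lambda>\<omega>.
         qform (mQ p t k) (X k \<omega>) + qform (mQ_bar p t k) (cond_vec M w t (X k) \<omega>)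
         + qform (mR p t k) (u k \<omega>) + qform (mR_bar p t k) (cond_vec M w t (u k) \<omega>)
         + 2 * (vq p t k \<bullet> X k \<omega>) + 2 * (vrho p t k \<bullet> u k \<omega>)) \<omega>)
     + cond_real M w t (\<lambda>\<omega>. qform (mG p t) (X N \<omega>)) \<omega>
     + qform (mG_bar p t) (cond_vec M w t (X N) \<omega>)
     + 2 * cond_real M w t (\<lambda>\<omega>. vg p t \<bullet> X N \<omega>) \<omega>))"

text \<open>Replacing the control at time \<open>k\<close> is the function update \<open>u(k := v)\<close>; the cost from time \<open>k\<close> on
  does not depend on \<open>u\<close> at times before \<open>k\<close>, so no restriction needs to be written.\<close>

definition pointwise_convex_at ::
    "'a measure \<Rightarrow> (nat \<Rightarrow> 'a \<Rightarrow> real) \<Rightarrow> nat \<Rightarrow> ('n::finite, 'm::finite) lq_data \<Rightarrow> nat \<Rightarrow>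
     ('a \<Rightarrow> real ^ 'n) \<Rightarrow> bool" where
  "pointwise_convex_at M w N p k \<zeta> \<longleftrightarrow>
     (\<forall>u \<in> L2F_proc M w N (Suc k). \<forall>v1 \<in> L2F M w k. \<forall>v2 \<in> L2F M w k. \<forall>c\<in>{0..1::real}.
        AE \<omega> in M.
          cost M w N p k \<zeta> (u(k := \<lambda>\<omega>. c *\<^sub>R v1 \<omega> + (1 - c) *\<^sub>R v2 \<omega>)) \<omega>
          \<le> c * cost M w N p k \<zeta> (u(k := v1)) \<omega> + (1 - c) * cost M w N p k \<zeta> (u(k := v2)) \<omega>)"

text \<open>The state equation of an equilibrium pair is only required almost surely, so the standing
  requirement \<open>X k \<in> L2F M w k\<close>, needed for the cost from \<open>(k, X k)\<close> to be defined, is explicit; every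
  almost sure solution has such a modification.\<close>

definition open_loop_equilibrium_pair ::
    "'a measure \<Rightarrow> (nat \<Rightarrow> 'a \<Rightarrow> real) \<Rightarrow> nat \<Rightarrow> ('n::finite, 'm::finite) lq_data \<Rightarrow> nat \<Rightarrow>
     ('a \<Rightarrow> real ^ 'n) \<Rightarrow> (nat \<Rightarrow> 'a \<Rightarrow> real ^ 'n) \<Rightarrow> (nat \<Rightarrow> 'a \<Rightarrow> real ^ 'm) \<Rightarrow> bool" where
  "open_loop_equilibrium_pair M w N p t x X u \<longleftrightarrow>
     u \<in> L2F_proc M w N t \<and>
     (\<forall>k\<in>{t..N}. X k \<in> L2F M w k) \<and>
     (AE \<omega> in M. X t \<omega> = x \<omega>) \<and>
     (\<forall>k\<in>{t..<N}. AE \<omega> in M. X (Suc k) \<omega> =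
        (calA p k k *v X k \<omega> + calB p k k *v u k \<omega> + vf p k k)
        + w k \<omega> *\<^sub>R (calC p k k *v X k \<omega> + calD p k k *v u k \<omega> + vd p k k)) \<and>
     (\<forall>k\<in>{t..<N}. \<forall>v \<in> L2F M w k. AE \<omega> in M.
        cost M w N p k (X k) u \<omega> \<le> cost M w N p k (X k) (u(k := v)) \<omega>)"

text \<open>As for \<open>state\<close>, only the values at times \<open>\<ge> k\<close> are meaningful.\<close>

primrec hom_state ::
    "'a measure \<Rightarrow> (nat \<Rightarrow> 'a \<Rightarrow> real) \<Rightarrow> ('n::finite, 'm::finite) lq_data \<Rightarrow> nat \<Rightarrow>
     ('a \<Rightarrow> real ^ 'm) \<Rightarrow> nat \<Rightarrow> 'a \<Rightarrow> real ^ 'n" where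
  "hom_state M w p k v 0 = (\<lambda>\<omega>. 0)"
| "hom_state M w p k v (Suc l) =
     (if l < k then (\<lambda>\<omega>. 0)
      else if l = k then (\<lambda>\<omega>. calB p k k *v v \<omega> + w k \<omega> *\<^sub>R (calD p k k *v v \<omega>))
      else (let Y = hom_state M w p k v l in (\<lambda>\<omega>.
        mA p k l *v Y \<omega> + mA_bar p k l *v cond_vec M w k Y \<omega>
        + w l \<omega> *\<^sub>R (mC p k l *v Y \<omega> + mC_bar p k l *v cond_vec M w k Y \<omega>))))"

definition hom_cost ::
    "'a measure \<Rightarrow> (nat \<Rightarrow> 'a \<Rightarrow> real) \<Rightarrow> nat \<Rightarrow> ('n::finite, 'm::finite) lq_data \<Rightarrow> nat \<Rightarrow>
     ('a \<Rightarrow> real ^ 'm) \<Rightarrow> 'a \<Rightarrow> real" where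
  "hom_cost M w N p k v = (let Y = hom_state M w p k v in (\<lambda>\<omega>.
     (\<Sum>l=k..<N. cond_real M w k (\<lambda>\<omega>.
         qform (mQ p k l) (Y l \<omega>) + qform (mQ_bar p k l) (cond_vec M w k (Y l) \<omega>)) \<omega>)
     + qform (calR p k k) (v \<omega>)
     + cond_real M w k (\<lambda>\<omega>. qform (mG p k) (Y N \<omega>)) \<omega>
     + qform (mG_bar p k) (cond_vec M w k (Y N) \<omega>)))"

function ric_P :: "nat \<Rightarrow> ('n::finite, 'm::finite) lq_data \<Rightarrow> nat \<Rightarrow> nat \<Rightarrow> real ^ 'n ^ 'n" where
  "ric_P N p k l =
     (if N \<le> l then mG p k
      else mQ p k l + transpose (mA p k l) ** ric_P N p k (Suc l) ** mA p k l
           + transpose (mC p k l) ** ric_P N p k (Suc l) ** mC p k l)"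
  by pat_completeness auto
termination by (relation "Wellfounded.measure (\<lambda>(N, p, k, l). N - l)") auto

function ric_calP :: "nat \<Rightarrow> ('n::finite, 'm::finite) lq_data \<Rightarrow> nat \<Rightarrow> nat \<Rightarrow> real ^ 'n ^ 'n" where
  "ric_calP N p k l =
     (if N \<le> l then calG p k
      else calQ p k l + transpose (calA p k l) ** ric_calP N p k (Suc l) ** calA p k l
           + transpose (calC p k l) ** ric_P N p k (Suc l) ** calC p k l)"
  by pat_completeness auto
termination by (relation "Wellfounded.measure (\<lambda>(N, p, k, l). N - l)") auto

text \<open>The defining equations loop as simplification rules.\<close>

declare ric_P.simps [simp del] ric_calP.simps [simp del]

end

theory Submission
  imports Defs
begin

text \<open>Perturbing the control at time \<open>k\<close> by \<open>c z\<close> shifts the state by \<open>c\<close> times the homogeneous state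
  \<open>Y\<close> started by \<open>z\<close>. For every quadratic form \<open>q\<close> one has
  \<open>c q(x + y) + (1 - c) q(x) - q(x + c y) = c (1 - c) q(y)\<close>, so the convexity defect of the cost
  along \<open>v + c z\<close> equals \<open>c (1 - c)\<close> times \<open>hom_cost\<close> of \<open>z\<close>, whatever the initial state and the other
  controls are. Hence convexity at one initial state, convexity at all of them and nonnegativity of
  \<open>hom_cost\<close> agree. An equilibrium control is the midpoint of two deviations that do not improve on
  it, which again forces \<open>hom_cost\<close> to be nonnegative. Finally, the Riccati recursions telescope
  \<open>hom_cost\<close> of \<open>v\<close> to the quadratic form of condition (ii) at \<open>v\<close>; constant controls then give its
  positive semidefiniteness.\<close>

subsection \<open>Square-integrable adapted vectors\<close>

context mds_noise
begin

section \<open>The filtration generated by the noise\<close>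

lemma space_filt [simp]: "space (filt M w k) = space M"
  by (simp add: filt_def space_measure_of_conv)

lemma sets_filt:
  "sets (filt M w k) =
     sigma_sets (space M) {w i -` S \<inter> space M | i S. i < k \<and> S \<in> sets borel}"
  unfolding filt_def by (rule sets_measure_of) auto

text \<open>The generators involve only \<open>w i\<close> with \<open>i < k\<close>, so
  \<open>k \<le> N\<close> places them all among the noises that the locale declares
  measurable.\<close>

lemma subalgebra_filt:
  assumes "k \<le> N"
  shows "subalgebra M (filt M w k)"
proof -
  have "{w i -` S \<inter> space M | i S. i < k \<and> S \<in> sets borel} \<subseteq> sets M"
    using assms by (auto intro!: measurable_sets[OF w_measurable])
  then show ?thesis
    unfolding subalgebra_def sets_filt by (simp add: sets.sigma_sets_subset)
qed

lemma subalgebra_filt_mono: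
  assumes "j \<le> k"
  shows "subalgebra (filt M w k) (filt M w j)"
proof -
  have "{w i -` S \<inter> space M | i S. i < j \<and> S \<in> sets borel}
      \<subseteq> {w i -` S \<inter> space M | i S. i < k \<and> S \<in> sets borel}"
    using assms less_le_trans by blast
  then show ?thesis
    unfolding subalgebra_def sets_filt by (simp add: sigma_sets_mono')
qed

lemma w_measurable_filt: "w k \<in> borel_measurable (filt M w (Suc k))"
proof (rule measurableI)
  fix S :: "real set"
  assume "S \<in> sets borel"
  then show "w k -` S \<inter> space (filt M w (Suc k)) \<in> sets (filt M w (Suc k))"
    unfolding sets_filt by (auto intro!: sigma_sets.Basic)
qed simp

text \<open>On a probability space every sub-sigma-algebra is sigma-finite, which is the setting in
  which conditional expectations have their usual properties.\<close>

lemma sigma_finite_filt: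
  assumes "k \<le> N"
  shows "sigma_finite_subalgebra M (filt M w k)"
  by (intro finite_measure_subalgebra_is_sigma_finite finite_measure_subalgebra.intro
      finite_measure_subalgebra_axioms.intro subalgebra_filt assms finite_measure_axioms)

section \<open>Closure properties of square-integrable adapted vectors\<close>

lemma L2F_measurable:
  assumes "X \<in> L2F M w k" "k \<le> N"
  shows "X \<in> borel_measurable M"
  using assms measurable_from_subalg[OF subalgebra_filt] by (auto simp: L2F_def)

lemma L2F_mono:
  assumes "X \<in> L2F M w j" "j \<le> k"
  shows "X \<in> L2F M w k"
  using assms measurable_from_subalg[OF subalgebra_filt_mono] by (auto simp: L2F_def)

lemma L2F_I_bound:
  fixes X :: "'a \<Rightarrow> real ^ 'd::finite"
  assumes "k \<le> N" and X: "X \<in> borel_measurable (filt M w k)"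
    and "integrable M g" "\<And>\<omega>. (norm (X \<omega>))\<^sup>2 \<le> g \<omega>"
  shows "X \<in> L2F M w k"
proof -
  have [measurable]: "X \<in> borel_measurable M"
    using assms measurable_from_subalg[OF subalgebra_filt] by blast
  have "integrable M (\<lambda>\<omega>. (norm (X \<omega>))\<^sup>2)"
  proof (rule Bochner_Integration.integrable_bound[OF \<open>integrable M g\<close>])
    show "AE \<omega> in M. norm ((norm (X \<omega>))\<^sup>2) \<le> norm (g \<omega>)"
      using assms(4) by (intro AE_I2) (smt (verit) real_norm_def zero_le_power2)
  qed measurable
  with X show ?thesis
    by (simp add: L2F_def)
qed

lemma L2F_add:
  fixes X Y :: "'a \<Rightarrow> real ^ 'd::finite"
  assumes "k \<le> N" "X \<in> L2F M w k" "Y \<in> L2F M w k"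
  shows "(\<lambda>\<omega>. X \<omega> + Y \<omega>) \<in> L2F M w k"
proof (rule L2F_I_bound[where g="\<lambda>\<omega>. 2 * (norm (X \<omega>))\<^sup>2 + 2 * (norm (Y \<omega>))\<^sup>2"])
  show "(norm (X \<omega> + Y \<omega>))\<^sup>2 \<le> 2 * (norm (X \<omega>))\<^sup>2 + 2 * (norm (Y \<omega>))\<^sup>2" for \<omega>
    using norm_triangle_ineq[of "X \<omega>" "Y \<omega>"] sum_squares_bound[of "norm (X \<omega>)" "norm (Y \<omega>)"]
      power_mono[OF norm_triangle_ineq[of "X \<omega>" "Y \<omega>"], of 2]
    by (simp add: power2_sum)
qed (use assms in \<open>auto simp: L2F_def\<close>)

lemma L2F_matrix:
  fixes X :: "'a \<Rightarrow> real ^ 'd::finite" and S :: "real ^ 'd ^ 'e::finite"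
  assumes "k \<le> N" "X \<in> L2F M w k"
  shows "(\<lambda>\<omega>. S *v X \<omega>) \<in> L2F M w k"
proof (rule L2F_I_bound[where g="\<lambda>\<omega>. (onorm ((*v) S))\<^sup>2 * (norm (X \<omega>))\<^sup>2"])
  have "(*v) S \<in> borel_measurable borel"
    by (intro borel_measurable_continuous_onI linear_continuous_on matrix_vector_mul_bounded_linear)
  moreover have "X \<in> borel_measurable (filt M w k)"
    using assms by (simp add: L2F_def)
  ultimately show "(\<lambda>\<omega>. S *v X \<omega>) \<in> borel_measurable (filt M w k)"
    by (rule measurable_compose[rotated])
  show "(norm (S *v X \<omega>))\<^sup>2 \<le> (onorm ((*v) S))\<^sup>2 * (norm (X \<omega>))\<^sup>2" for \<omega>
    using power_mono[OF onorm[OF matrix_vector_mul_bounded_linear, of S "X \<omega>"], of 2]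
    by (simp add: power_mult_distrib)
qed (use assms in \<open>auto simp: L2F_def\<close>)

lemma L2F_scaleR:
  fixes X :: "'a \<Rightarrow> real ^ 'd::finite"
  assumes "X \<in> L2F M w k"
  shows "(\<lambda>\<omega>. c *\<^sub>R X \<omega>) \<in> L2F M w k"
  using assms by (auto simp: L2F_def power_mult_distrib)

lemma L2F_const: "(\<lambda>\<omega>. x) \<in> L2F M w k"
  by (auto simp: L2F_def)

text \<open>Follows from 2ab \<le> a^2 + b^2. Leaving \<open>h\<close> free lets inner products and
  products of single coordinates, even of vectors of different dimensions, share the
  estimate.\<close>

lemma L2F_integrable_product_bound:
  fixes X :: "'a \<Rightarrow> real ^ 'd::finite" and Y :: "'a \<Rightarrow> real ^ 'e::finite"
  assumes "k \<le> N" "X \<in> L2F M w k" "Y \<in> L2F M w k"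
    and h: "h \<in> borel_measurable M" "\<And>\<omega>. \<bar>h \<omega>\<bar> \<le> norm (X \<omega>) * norm (Y \<omega>)"
  shows "integrable M h"
proof (rule Bochner_Integration.integrable_bound[where f="\<lambda>\<omega>. (norm (X \<omega>))\<^sup>2 + (norm (Y \<omega>))\<^sup>2"])
  show "integrable M (\<lambda>\<omega>. (norm (X \<omega>))\<^sup>2 + (norm (Y \<omega>))\<^sup>2)"
    using assms by (auto simp: L2F_def)
  have "\<bar>h \<omega>\<bar> \<le> (norm (X \<omega>))\<^sup>2 + (norm (Y \<omega>))\<^sup>2" for \<omega>
    using h(2)[of \<omega>] sum_squares_bound[of "norm (X \<omega>)" "norm (Y \<omega>)"]
      mult_nonneg_nonneg[OF norm_ge_zero norm_ge_zero, of "X \<omega>" "Y \<omega>"] by linarith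
  then show "AE \<omega> in M. norm (h \<omega>) \<le> norm ((norm (X \<omega>))\<^sup>2 + (norm (Y \<omega>))\<^sup>2)"
    by simp
qed (rule h(1))

lemma L2F_integrable_inner:
  fixes X Y :: "'a \<Rightarrow> real ^ 'd::finite"
  assumes "k \<le> N" "X \<in> L2F M w k" "Y \<in> L2F M w k"
  shows "integrable M (\<lambda>\<omega>. X \<omega> \<bullet> Y \<omega>)"
  by (intro L2F_integrable_product_bound[OF assms] borel_measurable_inner Cauchy_Schwarz_ineq2
      L2F_measurable[OF _ assms(1)] assms)

lemma measurable_vec_nth:
  fixes X :: "'b \<Rightarrow> real ^ 'd::finite"
  assumes "X \<in> borel_measurable K"
  shows "(\<lambda>\<omega>. X \<omega> $ i) \<in> borel_measurable K"
proof -
  have "(\<lambda>\<omega>. X \<omega> \<bullet> axis i 1) \<in> borel_measurable K"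
    using assms by (intro borel_measurable_inner) auto
  then show ?thesis
    by (simp add: inner_axis)
qed

lemma L2F_integrable_nth_mult:
  fixes X :: "'a \<Rightarrow> real ^ 'd::finite" and Y :: "'a \<Rightarrow> real ^ 'e::finite"
  assumes "k \<le> N" "X \<in> L2F M w k" "Y \<in> L2F M w k"
  shows "integrable M (\<lambda>\<omega>. X \<omega> $ i * Y \<omega> $ j)"
proof (rule L2F_integrable_product_bound[OF assms])
  show "(\<lambda>\<omega>. X \<omega> $ i * Y \<omega> $ j) \<in> borel_measurable M"
    by (intro borel_measurable_times measurable_vec_nth L2F_measurable[OF _ assms(1)] assms)
  show "\<bar>X \<omega> $ i * Y \<omega> $ j\<bar> \<le> norm (X \<omega>) * norm (Y \<omega>)" for \<omega>
    unfolding abs_mult by (intro mult_mono component_le_norm_cart) auto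
qed

lemma L2F_integrable_nth:
  fixes X :: "'a \<Rightarrow> real ^ 'd::finite"
  assumes "k \<le> N" "X \<in> L2F M w k"
  shows "integrable M (\<lambda>\<omega>. X \<omega> $ i)"
  using L2F_integrable_inner[OF assms L2F_const[of "axis i 1"]] by (simp add: inner_axis)

lemma L2F_inner_measurable:
  fixes X Y :: "'a \<Rightarrow> real ^ 'd::finite"
  assumes "X \<in> L2F M w k" "Y \<in> L2F M w k"
  shows "(\<lambda>\<omega>. X \<omega> \<bullet> Y \<omega>) \<in> borel_measurable (filt M w k)"
  using assms unfolding L2F_def by (intro borel_measurable_inner) simp_all

section \<open>Conditional means and noise multiples of square-integrable vectors\<close>

lemma cond_vec_measurable:
  "(cond_vec M w k X :: 'a \<Rightarrow> real ^ 'd::finite) \<in> borel_measurable (filt M w k)"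
proof (rule borel_measurable_euclidean_space[THEN iffD2], rule ballI)
  fix b :: "real ^ 'd"
  assume "b \<in> Basis"
  then obtain i where "b = axis i 1"
    by (auto simp: Basis_vec_def)
  then have "(\<lambda>\<omega>. cond_vec M w k X \<omega> \<bullet> b) = cond_real M w k (\<lambda>\<omega>. X \<omega> $ i)"
    by (simp add: cond_vec_def inner_axis)
  then show "(\<lambda>\<omega>. cond_vec M w k X \<omega> \<bullet> b) \<in> borel_measurable (filt M w k)"
    by (simp only: borel_measurable_cond_exp)
qed

text \<open>Conditional Jensen inequality for the square, coordinate by coordinate. Asking for level
  \<open>N\<close> covers vectors of every earlier time, since the filtration increases.\<close>

lemma L2F_cond_vec:
  fixes X :: "'a \<Rightarrow> real ^ 'd::finite"
  assumes "k \<le> N" "X \<in> L2F M w N"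
  shows "cond_vec M w k X \<in> L2F M w k"
proof (rule L2F_I_bound)
  interpret F: sigma_finite_subalgebra M "filt M w k"
    by (rule sigma_finite_filt[OF assms(1)])
  have "integrable M (\<lambda>\<omega>. (cond_real M w k (\<lambda>\<omega>. X \<omega> $ i) \<omega>)\<^sup>2)" for i
  proof (rule F.integrable_convex_cond_exp[where I=UNIV])
    show "integrable M (\<lambda>\<omega>. X \<omega> $ i)"
      using L2F_integrable_nth assms by blast
    show "integrable M (\<lambda>\<omega>. (X \<omega> $ i)\<^sup>2)"
      using L2F_integrable_nth_mult[OF order_refl assms(2,2), of i i] by (simp add: power2_eq_square)
  qed (auto intro: convex_power2)
  then show "integrable M (\<lambda>\<omega>. \<Sum>i\<in>UNIV. (cond_real M w k (\<lambda>\<omega>. X \<omega> $ i) \<omega>)\<^sup>2)"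
    by auto
  show "(norm (cond_vec M w k X \<omega>))\<^sup>2 \<le> (\<Sum>i\<in>UNIV. (cond_real M w k (\<lambda>\<omega>. X \<omega> $ i) \<omega>)\<^sup>2)" for \<omega>
    unfolding norm_vec_def L2_set_def cond_vec_def by (simp add: sum_nonneg)
qed (use assms cond_vec_measurable in auto)

text \<open>Restates the variance assumption for nonnegative conditional expectations, so that it
  can be used before a product with the squared noise is known to be integrable. The negative part
  of a square contributes zero.\<close>

lemma nn_cond_exp_w_sq:
  assumes "l < N"
  shows "AE \<omega> in M. nn_cond_exp M (filt M w l) (\<lambda>\<omega>. ennreal ((w l \<omega>)\<^sup>2)) \<omega> = 1"
proof -
  interpret F: sigma_finite_subalgebra M "filt M w l"
    by (rule sigma_finite_filt) (use assms in simp)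
  have "(\<lambda>\<omega>. ennreal (- (w l \<omega>)\<^sup>2)) = (\<lambda>\<omega>. 0)"
    by (auto simp: ennreal_neg)
  then have "AE \<omega> in M. nn_cond_exp M (filt M w l) (\<lambda>\<omega>. ennreal (- (w l \<omega>)\<^sup>2)) \<omega> = 0"
    using F.nn_cond_exp_F_meas[of "\<lambda>\<omega>. 0"] by auto
  with w_variance[OF assms] show ?thesis
    unfolding real_cond_exp_def
  proof eventually_elim
    case (elim \<omega>)
    \<comment> \<open>The case split rules out the value \<open>\<infinity>\<close>:
      \<open>enn2real\<close> sends it to 0, which contradicts conditional variance 1.\<close>
    then show ?case
      by (cases "nn_cond_exp M (filt M w l) (\<lambda>\<omega>. ennreal ((w l \<omega>)\<^sup>2)) \<omega>") auto
  qed
qed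

text \<open>A product of square-integrable factors need not be square integrable; here adaptedness
  of \<open>b\<close> and conditional variance 1 give E|w_l b|^2 = E|b|^2. Finiteness is the claim
  itself, so the computation runs with nonnegative integrals.\<close>

lemma L2F_noise:
  fixes b :: "'a \<Rightarrow> real ^ 'd::finite"
  assumes "l < N" "b \<in> L2F M w l"
  shows "(\<lambda>\<omega>. w l \<omega> *\<^sub>R b \<omega>) \<in> L2F M w (Suc l)"
proof -
  interpret F: sigma_finite_subalgebra M "filt M w l"
    by (rule sigma_finite_filt) (use assms in simp)
  have b: "b \<in> borel_measurable (filt M w l)"
    using assms(2) by (simp add: L2F_def)
  then have b_sq: "(\<lambda>\<omega>. ennreal ((norm (b \<omega>))\<^sup>2)) \<in> borel_measurable (filt M w l)"
    by measurable
  have [measurable]: "b \<in> borel_measurable M"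
    using L2F_measurable[OF assms(2)] assms(1) by simp
  have [measurable]: "w l \<in> borel_measurable M"
    using w_measurable assms(1) .
  have "(\<integral>\<^sup>+\<omega>. ennreal (norm ((norm (w l \<omega> *\<^sub>R b \<omega>))\<^sup>2)) \<partial>M) =
      (\<integral>\<^sup>+\<omega>. ennreal ((norm (b \<omega>))\<^sup>2) * ennreal ((w l \<omega>)\<^sup>2) \<partial>M)"
  proof (rule nn_integral_cong)
    show "ennreal (norm ((norm (w l \<omega> *\<^sub>R b \<omega>))\<^sup>2)) =
        ennreal ((norm (b \<omega>))\<^sup>2) * ennreal ((w l \<omega>)\<^sup>2)" for \<omega>
      by (simp add: power_mult_distrib mult.commute flip: ennreal_mult)
  qed
  also have "\<dots> = (\<integral>\<^sup>+\<omega>. ennreal ((norm (b \<omega>))\<^sup>2) *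
      nn_cond_exp M (filt M w l) (\<lambda>\<omega>. ennreal ((w l \<omega>)\<^sup>2)) \<omega> \<partial>M)"
    by (rule F.nn_cond_exp_intg[symmetric, OF b_sq]) measurable
  also have "\<dots> = (\<integral>\<^sup>+\<omega>. ennreal ((norm (b \<omega>))\<^sup>2) \<partial>M)"
  proof (rule nn_integral_cong_AE)
    show "AE \<omega> in M. ennreal ((norm (b \<omega>))\<^sup>2) *
        nn_cond_exp M (filt M w l) (\<lambda>\<omega>. ennreal ((w l \<omega>)\<^sup>2)) \<omega> = ennreal ((norm (b \<omega>))\<^sup>2)"
      using nn_cond_exp_w_sq[OF assms(1)] by eventually_elim simp
  qed
  also have "\<dots> < \<infinity>"
    using assms(2) unfolding L2F_def integrable_iff_bounded by simp
  finally have "integrable M (\<lambda>\<omega>. (norm (w l \<omega> *\<^sub>R b \<omega>))\<^sup>2)"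
    unfolding integrable_iff_bounded by simp
  moreover have "b \<in> borel_measurable (filt M w (Suc l))"
    using L2F_mono[OF assms(2), of "Suc l"] by (simp add: L2F_def)
  ultimately show ?thesis
    using w_measurable_filt[of l] unfolding L2F_def
    by (intro CollectI conjI borel_measurable_scaleR)
qed

end

subsection \<open>Conditional expectations of vectors and quadratic forms\<close>

lemma qform_add:
  fixes S :: "real ^ 'd::finite ^ 'd"
  shows
  "qform S (x + y) = qform S x + x \<bullet> (S *v y) + y \<bullet> (S *v x) + qform S y"
  by (simp add: matrix_vector_right_distrib inner_add_left inner_add_right)

context mds_noise
begin

section \<open>Conditional expectations of vectors, coordinate by coordinate\<close>

lemma AE_vec_eqI:
  fixes f g :: "'a \<Rightarrow> real ^ 'd::finite"
  assumes "\<And>i. AE \<omega> in M. f \<omega> $ i = g \<omega> $ i"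
  shows "AE \<omega> in M. f \<omega> = g \<omega>"
proof -
  have "AE \<omega> in M. \<forall>i. f \<omega> $ i = g \<omega> $ i"
    using assms by (simp add: AE_all_countable)
  then show ?thesis
    by (simp add: vec_eq_iff)
qed

text \<open>The factor \<open>Z\<close> is known at time \<open>k\<close> and is pulled out of each
  coordinate product before summing.\<close>

lemma cond_real_inner:
  fixes X Z :: "'a \<Rightarrow> real ^ 'd::finite"
  assumes "k \<le> N" "Z \<in> L2F M w k" "X \<in> L2F M w N"
  shows "AE \<omega> in M. cond_real M w k (\<lambda>\<omega>. Z \<omega> \<bullet> X \<omega>) \<omega> = Z \<omega> \<bullet> cond_vec M w k X \<omega>"
proof -
  interpret F: sigma_finite_subalgebra M "filt M w k"
    by (rule sigma_finite_filt[OF assms(1)])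
  have int: "integrable M (\<lambda>\<omega>. Z \<omega> $ i * X \<omega> $ i)" for i
    using L2F_integrable_nth_mult[OF order_refl L2F_mono[OF assms(2,1)] assms(3)] .
  have "AE \<omega> in M. \<forall>i. cond_real M w k (\<lambda>\<omega>. Z \<omega> $ i * X \<omega> $ i) \<omega>
      = Z \<omega> $ i * cond_real M w k (\<lambda>\<omega>. X \<omega> $ i) \<omega>"
    unfolding AE_all_countable
  proof
    fix i
    show "AE \<omega> in M. cond_real M w k (\<lambda>\<omega>. Z \<omega> $ i * X \<omega> $ i) \<omega>
      = Z \<omega> $ i * cond_real M w k (\<lambda>\<omega>. X \<omega> $ i) \<omega>"
      using assms L2F_measurable[OF assms(3)]
      by (intro F.real_cond_exp_mult int measurable_vec_nth) (simp_all add: L2F_def)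
  qed
  moreover have "AE \<omega> in M. cond_real M w k (\<lambda>\<omega>. \<Sum>i\<in>UNIV. Z \<omega> $ i * X \<omega> $ i) \<omega>
      = (\<Sum>i\<in>UNIV. cond_real M w k (\<lambda>\<omega>. Z \<omega> $ i * X \<omega> $ i) \<omega>)"
    by (intro F.real_cond_exp_sum int)
  ultimately show ?thesis
    by eventually_elim (simp add: inner_vec_def cond_vec_def)
qed

lemma cond_vec_matrix:
  fixes X :: "'a \<Rightarrow> real ^ 'd::finite" and S :: "real ^ 'd ^ 'e::finite"
  assumes "k \<le> N" "X \<in> L2F M w N"
  shows "AE \<omega> in M. cond_vec M w k (\<lambda>\<omega>. S *v X \<omega>) \<omega> = S *v cond_vec M w k X \<omega>"
proof (rule AE_vec_eqI)
  fix i
  \<comment> \<open>A row of the product is an inner product with a constant vector, so the pull-out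
    rule for inner products applies.\<close>
  have row: "(S *v y) $ i = S $ i \<bullet> y" for y
    by (simp add: matrix_vector_mult_def inner_vec_def)
  show "AE \<omega> in M. cond_vec M w k (\<lambda>\<omega>. S *v X \<omega>) \<omega> $ i = (S *v cond_vec M w k X \<omega>) $ i"
    using cond_real_inner[OF assms(1) L2F_const assms(2), of "S $ i"]
    unfolding row by (simp add: cond_vec_def row)
qed

lemma cond_vec_add:
  fixes X Y :: "'a \<Rightarrow> real ^ 'd::finite"
  assumes "k \<le> N" "X \<in> L2F M w N" "Y \<in> L2F M w N"
  shows "AE \<omega> in M. cond_vec M w k (\<lambda>\<omega>. X \<omega> + Y \<omega>) \<omega> = cond_vec M w k X \<omega> + cond_vec M w k Y \<omega>"
proof (rule AE_vec_eqI)
  interpret F: sigma_finite_subalgebra M "filt M w k"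
    by (rule sigma_finite_filt[OF assms(1)])
  fix i
  show "AE \<omega> in M. cond_vec M w k (\<lambda>\<omega>. X \<omega> + Y \<omega>) \<omega> $ i =
      (cond_vec M w k X \<omega> + cond_vec M w k Y \<omega>) $ i"
    using F.real_cond_exp_add[OF L2F_integrable_nth[OF order_refl assms(2)]
        L2F_integrable_nth[OF order_refl assms(3)]]
    by (simp add: cond_vec_def)
qed

lemma cond_vec_scaleR:
  fixes X :: "'a \<Rightarrow> real ^ 'd::finite"
  assumes "k \<le> N" "X \<in> L2F M w N"
  shows "AE \<omega> in M. cond_vec M w k (\<lambda>\<omega>. c *\<^sub>R X \<omega>) \<omega> = c *\<^sub>R cond_vec M w k X \<omega>"
proof (rule AE_vec_eqI)
  interpret F: sigma_finite_subalgebra M "filt M w k"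
    by (rule sigma_finite_filt[OF assms(1)])
  fix i
  show "AE \<omega> in M. cond_vec M w k (\<lambda>\<omega>. c *\<^sub>R X \<omega>) \<omega> $ i = (c *\<^sub>R cond_vec M w k X \<omega>) $ i"
    using F.real_cond_exp_cmult[OF L2F_integrable_nth[OF order_refl assms(2)]]
    by (simp add: cond_vec_def)
qed

lemma cond_vec_cong:
  fixes X Y :: "'a \<Rightarrow> real ^ 'd::finite"
  assumes "k \<le> N" "X \<in> L2F M w N" "Y \<in> L2F M w N" "AE \<omega> in M. X \<omega> = Y \<omega>"
  shows "AE \<omega> in M. cond_vec M w k X \<omega> = cond_vec M w k Y \<omega>"
proof (rule AE_vec_eqI)
  interpret F: sigma_finite_subalgebra M "filt M w k"
    by (rule sigma_finite_filt[OF assms(1)])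
  fix i
  have "AE \<omega> in M. X \<omega> $ i = Y \<omega> $ i"
    using assms(4) by eventually_elim simp
  then show "AE \<omega> in M. cond_vec M w k X \<omega> $ i = cond_vec M w k Y \<omega> $ i"
    unfolding cond_vec_def vec_lambda_beta
    by (rule F.real_cond_exp_cong) (use assms L2F_measurable in \<open>auto intro!: measurable_vec_nth\<close>)
qed

lemma cond_vec_F_meas:
  fixes X :: "'a \<Rightarrow> real ^ 'd::finite"
  assumes "k \<le> N" "X \<in> L2F M w k"
  shows "AE \<omega> in M. cond_vec M w k X \<omega> = X \<omega>"
proof (rule AE_vec_eqI)
  interpret F: sigma_finite_subalgebra M "filt M w k"
    by (rule sigma_finite_filt[OF assms(1)])
  fix i
  have "(\<lambda>\<omega>. X \<omega> $ i) \<in> borel_measurable (filt M w k)"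
    using assms by (intro measurable_vec_nth) (simp add: L2F_def)
  then show "AE \<omega> in M. cond_vec M w k X \<omega> $ i = X \<omega> $ i"
    unfolding cond_vec_def vec_lambda_beta
    using L2F_integrable_nth[OF assms] by (intro F.real_cond_exp_F_meas)
qed

section \<open>Averaging out the noise\<close>

lemma cond_real_mult_w:
  assumes "k \<le> l" "l < N" and h: "h \<in> borel_measurable (filt M w l)"
    and int: "integrable M (\<lambda>\<omega>. h \<omega> * w l \<omega>)"
  shows "AE \<omega> in M. cond_real M w k (\<lambda>\<omega>. h \<omega> * w l \<omega>) \<omega> = 0"
proof -
  interpret F: sigma_finite_subalgebra M "filt M w k"
    by (rule sigma_finite_filt) (use assms in simp)
  interpret G: sigma_finite_subalgebra M "filt M w l"
    by (rule sigma_finite_filt) (use assms in simp)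
  \<comment> \<open>Conditioning first at the later time \<open>l\<close> makes \<open>h\<close> a
    known factor; the tower property then passes to time \<open>k\<close>.\<close>
  have "AE \<omega> in M. cond_real M w l (\<lambda>\<omega>. h \<omega> * w l \<omega>) \<omega> = 0"
    using G.real_cond_exp_mult[OF h w_measurable int] w_mean[OF assms(2)] assms(2)
    by (auto elim: AE_mp)
  then have "AE \<omega> in M. cond_real M w k (cond_real M w l (\<lambda>\<omega>. h \<omega> * w l \<omega>)) \<omega>
      = cond_real M w k (\<lambda>\<omega>. 0) \<omega>"
    by (rule F.real_cond_exp_cong) simp_all
  moreover have "AE \<omega> in M. cond_real M w k (\<lambda>\<omega>. 0) \<omega> = 0"
    by (rule F.real_cond_exp_F_meas) simp_all
  moreover have "AE \<omega> in M. cond_real M w k (cond_real M w l (\<lambda>\<omega>. h \<omega> * w l \<omega>)) \<omega>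
      = cond_real M w k (\<lambda>\<omega>. h \<omega> * w l \<omega>) \<omega>"
    using assms by (intro F.real_cond_exp_nested_subalg subalgebra_filt subalgebra_filt_mono) auto
  ultimately show ?thesis
    by eventually_elim simp
qed

text \<open>The same two-stage conditioning as for the first power, with conditional variance 1 in
  place of conditional mean 0.\<close>

lemma cond_real_mult_w_sq:
  assumes "k \<le> l" "l < N" and h: "h \<in> borel_measurable (filt M w l)"
    and int: "integrable M (\<lambda>\<omega>. h \<omega> * (w l \<omega>)\<^sup>2)"
  shows "AE \<omega> in M. cond_real M w k (\<lambda>\<omega>. h \<omega> * (w l \<omega>)\<^sup>2) \<omega> = cond_real M w k h \<omega>"
proof -
  interpret F: sigma_finite_subalgebra M "filt M w k"
    by (rule sigma_finite_filt) (use assms in simp)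
  interpret G: sigma_finite_subalgebra M "filt M w l"
    by (rule sigma_finite_filt) (use assms in simp)
  have "AE \<omega> in M. cond_real M w l (\<lambda>\<omega>. h \<omega> * (w l \<omega>)\<^sup>2) \<omega> = h \<omega> * cond_real M w l (\<lambda>\<omega>. (w l \<omega>)\<^sup>2) \<omega>"
    by (rule G.real_cond_exp_mult[OF h _ int]) (use w_measurable[OF assms(2)] in measurable)
  then have "AE \<omega> in M. cond_real M w l (\<lambda>\<omega>. h \<omega> * (w l \<omega>)\<^sup>2) \<omega> = h \<omega>"
    using w_variance[OF assms(2)] by eventually_elim simp
  moreover have "h \<in> borel_measurable M"
    using measurable_from_subalg[OF subalgebra_filt h] assms(2) by simp
  ultimately have "AE \<omega> in M. cond_real M w k (cond_real M w l (\<lambda>\<omega>. h \<omega> * (w l \<omega>)\<^sup>2)) \<omega>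
      = cond_real M w k h \<omega>"
    by (intro F.real_cond_exp_cong) simp_all
  moreover have "AE \<omega> in M. cond_real M w k (cond_real M w l (\<lambda>\<omega>. h \<omega> * (w l \<omega>)\<^sup>2)) \<omega>
      = cond_real M w k (\<lambda>\<omega>. h \<omega> * (w l \<omega>)\<^sup>2) \<omega>"
    using assms by (intro F.real_cond_exp_nested_subalg subalgebra_filt subalgebra_filt_mono) auto
  ultimately show ?thesis
    by eventually_elim simp
qed

lemma L2F_integrable_bilinear:
  fixes X :: "'a \<Rightarrow> real ^ 'd::finite" and Y :: "'a \<Rightarrow> real ^ 'e::finite"
  assumes "k \<le> N" "X \<in> L2F M w k" "Y \<in> L2F M w k"
  shows "integrable M (\<lambda>\<omega>. X \<omega> \<bullet> (S *v Y \<omega>))"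
  by (intro L2F_integrable_inner[OF assms(1,2)] L2F_matrix assms)

lemma L2F_bilinear_measurable:
  fixes X :: "'a \<Rightarrow> real ^ 'd::finite" and Y :: "'a \<Rightarrow> real ^ 'e::finite"
  assumes "k \<le> N" "X \<in> L2F M w k" "Y \<in> L2F M w k"
  shows "(\<lambda>\<omega>. X \<omega> \<bullet> (S *v Y \<omega>)) \<in> borel_measurable (filt M w k)"
  by (intro L2F_inner_measurable L2F_matrix assms)

lemma cond_vec_noise:
  fixes b :: "'a \<Rightarrow> real ^ 'd::finite"
  assumes "k \<le> l" "l < N" "b \<in> L2F M w l"
  shows "AE \<omega> in M. cond_vec M w k (\<lambda>\<omega>. w l \<omega> *\<^sub>R b \<omega>) \<omega> = 0"
proof (rule AE_vec_eqI)
  fix i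
  have "(\<lambda>\<omega>. b \<omega> $ i) \<in> borel_measurable (filt M w l)"
    using assms by (intro measurable_vec_nth) (simp add: L2F_def)
  moreover have "integrable M (\<lambda>\<omega>. b \<omega> $ i * w l \<omega>)"
    using L2F_integrable_nth[OF _ L2F_noise[OF assms(2,3)], of i] assms(2) by (simp add: mult.commute)
  ultimately show "AE \<omega> in M. cond_vec M w k (\<lambda>\<omega>. w l \<omega> *\<^sub>R b \<omega>) \<omega> $ i = 0 $ i"
    using cond_real_mult_w[OF assms(1,2), of "\<lambda>\<omega>. b \<omega> $ i"]
    by (simp add: cond_vec_def mult.commute[of "w l _"])
qed

text \<open>The expansion has a part free of \<open>w l\<close>, a part linear in \<open>w l\<close>
  that averages to zero, and a part in its square that averages to the form at \<open>b\<close>.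
  Hence drift and diffusion contribute separately.\<close>

lemma cond_real_qform_noise:
  fixes a b :: "'a \<Rightarrow> real ^ 'd::finite"
  assumes "k \<le> l" "l < N" "a \<in> L2F M w l" "b \<in> L2F M w l"
  shows "AE \<omega> in M. cond_real M w k (\<lambda>\<omega>. qform S (a \<omega> + w l \<omega> *\<^sub>R b \<omega>)) \<omega>
    = cond_real M w k (\<lambda>\<omega>. qform S (a \<omega>)) \<omega> + cond_real M w k (\<lambda>\<omega>. qform S (b \<omega>)) \<omega>"
proof -
  interpret F: sigma_finite_subalgebra M "filt M w k"
    by (rule sigma_finite_filt) (use assms in simp)
  have l: "l \<le> N" "Suc l \<le> N" using assms by auto
  note a' = L2F_mono[OF assms(3), of "Suc l", simplified]
  note wb = L2F_noise[OF assms(2,4)]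
  define g where "g = (\<lambda>\<omega>. a \<omega> \<bullet> (S *v b \<omega>) + b \<omega> \<bullet> (S *v a \<omega>))"
  have ia: "integrable M (\<lambda>\<omega>. qform S (a \<omega>))"
    by (rule L2F_integrable_bilinear[OF l(1) assms(3,3)])
  have ig: "integrable M (\<lambda>\<omega>. g \<omega> * w l \<omega>)"
    using Bochner_Integration.integrable_add[OF L2F_integrable_bilinear[OF l(2) a' wb, of S]
        L2F_integrable_bilinear[OF l(2) wb a', of S]]
    by (simp add: g_def matrix_vector_mult_scaleR algebra_simps)
  have ib: "integrable M (\<lambda>\<omega>. qform S (b \<omega>) * (w l \<omega>)\<^sup>2)"
    using L2F_integrable_bilinear[OF l(2) wb wb, of S]
    by (simp add: matrix_vector_mult_scaleR algebra_simps power2_eq_square)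
  have eq: "(\<lambda>\<omega>. qform S (a \<omega> + w l \<omega> *\<^sub>R b \<omega>)) =
      (\<lambda>\<omega>. qform S (a \<omega>) + (g \<omega> * w l \<omega> + qform S (b \<omega>) * (w l \<omega>)\<^sup>2))"
    by (simp add: g_def qform_add matrix_vector_mult_scaleR algebra_simps power2_eq_square)
  have "AE \<omega> in M. cond_real M w k
      (\<lambda>\<omega>. qform S (a \<omega>) + (g \<omega> * w l \<omega> + qform S (b \<omega>) * (w l \<omega>)\<^sup>2)) \<omega>
    = cond_real M w k (\<lambda>\<omega>. qform S (a \<omega>)) \<omega>
      + cond_real M w k (\<lambda>\<omega>. g \<omega> * w l \<omega> + qform S (b \<omega>) * (w l \<omega>)\<^sup>2) \<omega>"
    by (intro F.real_cond_exp_add ia ig ib Bochner_Integration.integrable_add)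
  moreover have "AE \<omega> in M. cond_real M w k (\<lambda>\<omega>. g \<omega> * w l \<omega> + qform S (b \<omega>) * (w l \<omega>)\<^sup>2) \<omega>
    = cond_real M w k (\<lambda>\<omega>. g \<omega> * w l \<omega>) \<omega> + cond_real M w k (\<lambda>\<omega>. qform S (b \<omega>) * (w l \<omega>)\<^sup>2) \<omega>"
    by (intro F.real_cond_exp_add ig ib)
  moreover have "AE \<omega> in M. cond_real M w k (\<lambda>\<omega>. g \<omega> * w l \<omega>) \<omega> = 0"
    using assms unfolding g_def
    by (intro cond_real_mult_w ig[unfolded g_def] borel_measurable_add L2F_bilinear_measurable) auto
  moreover have "AE \<omega> in M. cond_real M w k (\<lambda>\<omega>. qform S (b \<omega>) * (w l \<omega>)\<^sup>2) \<omega>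
    = cond_real M w k (\<lambda>\<omega>. qform S (b \<omega>)) \<omega>"
    using assms by (intro cond_real_mult_w_sq ib L2F_bilinear_measurable) auto
  ultimately show ?thesis
    unfolding eq by eventually_elim simp
qed

text \<open>In the cross terms \<open>Z\<close> is paired with an \<open>F\<^sub>k\<close>-measurable vector and averages to \<open>E\<^sub>k Z\<close>; the
  difference on the right collects these terms and the form at \<open>F (E\<^sub>k Z)\<close>.\<close>

lemma cond_real_qform_mean:
  fixes Z :: "'a \<Rightarrow> real ^ 'd::finite" and S :: "real ^ 'e::finite ^ 'e"
  assumes "k \<le> N" "Z \<in> L2F M w N"
  shows "AE \<omega> in M. cond_real M w k (\<lambda>\<omega>. qform S (E *v Z \<omega> + F *v cond_vec M w k Z \<omega>)) \<omega>
    = cond_real M w k (\<lambda>\<omega>. qform S (E *v Z \<omega>)) \<omega>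
      + qform S ((E + F) *v cond_vec M w k Z \<omega>) - qform S (E *v cond_vec M w k Z \<omega>)"
proof -
  interpret F: sigma_finite_subalgebra M "filt M w k"
    by (rule sigma_finite_filt) (use assms in simp)
  define m where "m = cond_vec M w k Z"
  have m: "m \<in> L2F M w k"
    unfolding m_def by (rule L2F_cond_vec[OF assms])
  \<comment> \<open>\<open>S\<close> is a general matrix here, so the two cross terms, one with
    \<open>S\<close> and one with its transpose, are gathered into a single inner product with
    \<open>Z\<close>.\<close>
  define H where "H = transpose E ** S ** F + transpose E ** transpose S ** F"
  have Hm: "(\<lambda>\<omega>. H *v m \<omega>) \<in> L2F M w k"
    by (rule L2F_matrix[OF assms(1) m])
  have Fm: "(\<lambda>\<omega>. F *v m \<omega>) \<in> L2F M w k"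
    by (rule L2F_matrix[OF assms(1) m])
  have H: "(H *v y) \<bullet> x = (E *v x) \<bullet> (S *v (F *v y)) + (F *v y) \<bullet> (S *v (E *v x))" for x y
    unfolding H_def
    by (simp add: matrix_vector_mult_add_rdistrib inner_add_left dot_lmul_matrix
        inner_commute[of "S *v (F *v y)"] flip: matrix_vector_mul_assoc)
  have EZ: "(\<lambda>\<omega>. E *v Z \<omega>) \<in> L2F M w N"
    by (intro L2F_matrix assms order_refl)
  have i1: "integrable M (\<lambda>\<omega>. qform S (E *v Z \<omega>))"
    by (rule L2F_integrable_bilinear[OF order_refl EZ EZ])
  have i2: "integrable M (\<lambda>\<omega>. (H *v m \<omega>) \<bullet> Z \<omega>)"
    by (rule L2F_integrable_inner[OF order_refl L2F_mono[OF Hm assms(1)] assms(2)])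
  have i3: "integrable M (\<lambda>\<omega>. qform S (F *v m \<omega>))"
    by (rule L2F_integrable_bilinear[OF assms(1) Fm Fm])
  have eq: "(\<lambda>\<omega>. qform S (E *v Z \<omega> + F *v m \<omega>)) =
      (\<lambda>\<omega>. qform S (E *v Z \<omega>) + ((H *v m \<omega>) \<bullet> Z \<omega> + qform S (F *v m \<omega>)))"
    by (simp add: qform_add H add.assoc)
  have "AE \<omega> in M. cond_real M w k
      (\<lambda>\<omega>. qform S (E *v Z \<omega>) + ((H *v m \<omega>) \<bullet> Z \<omega> + qform S (F *v m \<omega>))) \<omega>
    = cond_real M w k (\<lambda>\<omega>. qform S (E *v Z \<omega>)) \<omega>
      + cond_real M w k (\<lambda>\<omega>. (H *v m \<omega>) \<bullet> Z \<omega> + qform S (F *v m \<omega>)) \<omega>"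
    by (intro F.real_cond_exp_add i1 i2 i3 Bochner_Integration.integrable_add)
  moreover have "AE \<omega> in M. cond_real M w k (\<lambda>\<omega>. (H *v m \<omega>) \<bullet> Z \<omega> + qform S (F *v m \<omega>)) \<omega>
    = cond_real M w k (\<lambda>\<omega>. (H *v m \<omega>) \<bullet> Z \<omega>) \<omega> + cond_real M w k (\<lambda>\<omega>. qform S (F *v m \<omega>)) \<omega>"
    by (intro F.real_cond_exp_add i2 i3)
  moreover have "AE \<omega> in M. cond_real M w k (\<lambda>\<omega>. (H *v m \<omega>) \<bullet> Z \<omega>) \<omega> = (H *v m \<omega>) \<bullet> m \<omega>"
    unfolding m_def by (rule cond_real_inner[OF assms(1) Hm[unfolded m_def] assms(2)])
  moreover have "AE \<omega> in M. cond_real M w k (\<lambda>\<omega>. qform S (F *v m \<omega>)) \<omega> = qform S (F *v m \<omega>)"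
    by (intro F.real_cond_exp_F_meas i3 L2F_bilinear_measurable[OF assms(1) Fm Fm])
  ultimately have "AE \<omega> in M. cond_real M w k (\<lambda>\<omega>. qform S (E *v Z \<omega> + F *v m \<omega>)) \<omega>
    = cond_real M w k (\<lambda>\<omega>. qform S (E *v Z \<omega>)) \<omega>
      + qform S ((E + F) *v m \<omega>) - qform S (E *v m \<omega>)"
    unfolding eq by eventually_elim (simp add: H matrix_vector_mult_add_rdistrib qform_add)
  then show ?thesis
    by (simp add: m_def)
qed

end

subsection \<open>Perturbation of the state\<close>

lemma qform_matrix_conj:
  fixes A :: "real ^ 'd::finite ^ 'e::finite"
  shows "qform (transpose A ** S ** A) x = qform S (A *v x)"
  by (metis dot_lmul_matrix inner_commute matrix_vector_mul_assoc transpose_matrix_vector)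

lemma qform_add_matrix: "qform (S + T) x = qform S x + qform T x"
  by (simp add: matrix_vector_mult_add_rdistrib inner_add_right)

lemma qform_diff_matrix: "qform (S - T) x = qform S x - qform T x"
  by (simp add: matrix_vector_mult_diff_rdistrib inner_diff_right)

text \<open>Terms constant or linear in \<open>y\<close> are affine along the segment and cancel.
  The term quadratic in \<open>y\<close> has weight \<open>c\<close> on the left and
  \<open>c\<close> squared at the intermediate point, whence \<open>c * (1 - c)\<close>.\<close>

lemma qform_convexity_defect:
  fixes S :: "real ^ 'd::finite ^ 'd"
  shows "c * qform S (x + y) + (1 - c) * qform S x
    = qform S (x + c *\<^sub>R y) + c * (1 - c) * qform S y"
  by (simp add: qform_add matrix_vector_mult_scaleR algebra_simps)

context mds_noise
begin

section \<open>The two state recursions\<close>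

lemma state_initial:
  assumes "l \<le> t"
  shows "state M w p t x u l = x"
  using assms by (cases l) auto

lemma state_Suc:
  assumes "t \<le> k"
  shows "state M w p t x u (Suc k) = (\<lambda>\<omega>.
      (mA p t k *v state M w p t x u k \<omega> + mA_bar p t k *v cond_vec M w t (state M w p t x u k) \<omega>
        + mB p t k *v u k \<omega> + mB_bar p t k *v cond_vec M w t (u k) \<omega> + vf p t k)
      + w k \<omega> *\<^sub>R
        (mC p t k *v state M w p t x u k \<omega> + mC_bar p t k *v cond_vec M w t (state M w p t x u k) \<omega>
        + mD p t k *v u k \<omega> + mD_bar p t k *v cond_vec M w t (u k) \<omega> + vd p t k))"
  using assms by (simp add: Let_def)

lemma hom_state_initial:
  assumes "l \<le> k"
  shows "hom_state M w p k v l = (\<lambda>\<omega>. 0)"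
  using assms by (cases l) auto

lemma state_L2F:
  assumes "t \<le> l" "l \<le> N" "x \<in> L2F M w t" "u \<in> L2F_proc M w N t"
  shows "state M w p t x u l \<in> L2F M w l"
  using assms(1,2)
proof (induction l rule: dec_induct)
  case base
  then show ?case
    using assms(3) by (simp add: state_initial)
next
  case (step l)
  then have l: "l < N" "l \<le> N" "Suc l \<le> N" "t \<le> N"
    by auto
  have X: "state M w p t x u l \<in> L2F M w l"
    using step by simp
  have u: "u l \<in> L2F M w l"
    using assms(4) step l by (auto simp: L2F_proc_def)
  have EX: "cond_vec M w t (state M w p t x u l) \<in> L2F M w l"
    by (rule L2F_mono[OF L2F_cond_vec[OF l(4) L2F_mono[OF X l(2)]] step(1)])
  have Eu: "cond_vec M w t (u l) \<in> L2F M w l"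
    by (rule L2F_mono[OF L2F_cond_vec[OF l(4) L2F_mono[OF u l(2)]] step(1)])
  \<comment> \<open>Drift and diffusion coefficients have the same shape, so this fact with
    schematic matrices is instantiated once for each.\<close>
  note drift = L2F_add[OF l(2) L2F_add[OF l(2) L2F_add[OF l(2) L2F_add[OF l(2)
    L2F_matrix[OF l(2) X] L2F_matrix[OF l(2) EX]] L2F_matrix[OF l(2) u]]
    L2F_matrix[OF l(2) Eu]] L2F_const]
  show ?case
    unfolding state_Suc[OF step(1)]
    by (rule L2F_add[OF l(3) L2F_mono[OF drift] L2F_noise[OF l(1) drift]]) simp
qed

lemma hom_state_Suc:
  assumes "k < l"
  shows "hom_state M w p k v (Suc l) = (\<lambda>\<omega>.
      (mA p k l *v hom_state M w p k v l \<omega>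
        + mA_bar p k l *v cond_vec M w k (hom_state M w p k v l) \<omega>)
      + w l \<omega> *\<^sub>R (mC p k l *v hom_state M w p k v l \<omega>
        + mC_bar p k l *v cond_vec M w k (hom_state M w p k v l) \<omega>))"
  using assms by (simp add: Let_def)

lemma hom_state_L2F:
  assumes "l \<le> N" "k \<le> N" "v \<in> L2F M w k"
  shows "hom_state M w p k v l \<in> L2F M w l"
  using assms(1)
proof (induction l)
  case 0
  then show ?case
    by (simp add: L2F_const)
next
  case (Suc l)
  then have l: "l < N" "l \<le> N" "Suc l \<le> N"
    by auto
  have Y: "hom_state M w p k v l \<in> L2F M w l"
    using Suc by simp
  consider "l < k" | "l = k" | "k < l"
    by linarith
  then show ?case
  proof cases
    case 1
    then show ?thesis
      by (simp add: L2F_const)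
  next
    case 2
    have v: "v \<in> L2F M w l"
      using assms(3) 2 by simp
    have "(\<lambda>\<omega>. calB p k k *v v \<omega> + w l \<omega> *\<^sub>R (calD p k k *v v \<omega>)) \<in> L2F M w (Suc l)"
      by (rule L2F_add[OF l(3) L2F_mono[OF L2F_matrix[OF l(2) v]] L2F_noise[OF l(1)
          L2F_matrix[OF l(2) v]]]) simp
    then show ?thesis
      using 2 by simp
  next
    case 3
    have m: "cond_vec M w k (hom_state M w p k v l) \<in> L2F M w l"
      by (rule L2F_mono[OF L2F_cond_vec[OF assms(2) L2F_mono[OF Y l(2)]]]) (use 3 in simp)
    note drift = L2F_add[OF l(2) L2F_matrix[OF l(2) Y] L2F_matrix[OF l(2) m]]
    show ?thesis
      unfolding hom_state_Suc[OF 3]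
      by (rule L2F_add[OF l(3) L2F_mono[OF drift] L2F_noise[OF l(1) drift]]) simp
  qed
qed

section \<open>Dependence of the state on the control at the initial time\<close>

lemma L2F_proc_upd:
  assumes "u \<in> L2F_proc M w N (Suc k)" "v \<in> L2F M w k"
  shows "u(k := v) \<in> L2F_proc M w N k"
  using assms by (auto simp: L2F_proc_def)

lemma cond_vec_add_scaleR:
  fixes X Y :: "'a \<Rightarrow> real ^ 'd::finite"
  assumes "k \<le> N" "X \<in> L2F M w N" "Y \<in> L2F M w N" "Z \<in> L2F M w N"
    and "AE \<omega> in M. Z \<omega> = X \<omega> + c *\<^sub>R Y \<omega>"
  shows "AE \<omega> in M. cond_vec M w k Z \<omega> = cond_vec M w k X \<omega> + c *\<^sub>R cond_vec M w k Y \<omega>"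
proof -
  have cY: "(\<lambda>\<omega>. c *\<^sub>R Y \<omega>) \<in> L2F M w N"
    by (rule L2F_scaleR[OF assms(3)])
  show ?thesis
    using cond_vec_cong[OF assms(1,4) L2F_add[OF order_refl assms(2) cY] assms(5)]
      cond_vec_add[OF assms(1,2) cY] cond_vec_scaleR[OF assms(1,3), of c]
    by eventually_elim simp
qed

text \<open>The recursion is affine, so the difference of two states with the same start solves its
  homogeneous version; \<open>\<zeta>\<close>, the offsets and all controls after \<open>k\<close>
  drop out.\<close>

lemma state_perturbation:
  assumes "k < N" "\<zeta> \<in> L2F M w k" "u \<in> L2F_proc M w N (Suc k)"
    "v \<in> L2F M w k" "z \<in> L2F M w k" "k \<le> l" "l \<le> N"
  shows "AE \<omega> in M. state M w p k \<zeta> (u(k := (\<lambda>\<omega>. v \<omega> + c *\<^sub>R z \<omega>))) l \<omega>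
    = state M w p k \<zeta> (u(k := v)) l \<omega> + c *\<^sub>R hom_state M w p k z l \<omega>"
  using assms(6,7)
proof (induction l rule: dec_induct)
  case base
  then show ?case
    by (simp add: state_initial hom_state_initial)
next
  case (step l)
  have k: "k \<le> N" and l: "l \<le> N"
    using step assms by auto
  define vc where "vc = (\<lambda>\<omega>. v \<omega> + c *\<^sub>R z \<omega>)"
  have vc: "vc \<in> L2F M w k"
    unfolding vc_def by (intro L2F_add k assms L2F_scaleR)
  show ?case
  proof (cases "l = k")
    case True
    \<comment> \<open>At the initial time the control equals its own conditional mean, so plain and
      barred coefficients merge into \<open>calB\<close> and \<open>calD\<close>.\<close>
    have "AE \<omega> in M. cond_vec M w k vc \<omega> = vc \<omega>" "AE \<omega> in M. cond_vec M w k v \<omega> = v \<omega>"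
      using cond_vec_F_meas[OF k] vc assms by auto
    then show ?thesis
      unfolding vc_def[symmetric]
    proof eventually_elim
      case (elim \<omega>)
      then show ?case
        using True
        by (simp add: state_initial Let_def vc_def matrix_vector_mult_add_rdistrib
            matrix_vector_right_distrib matrix_vector_mult_scaleR algebra_simps)
    qed
  next
    case False
    \<comment> \<open>After time \<open>k\<close> the two control processes coincide, so only the
      difference of the states propagates.\<close>
    with step have "k < l" by simp
    have IH: "AE \<omega> in M. state M w p k \<zeta> (u(k := vc)) l \<omega>
        = state M w p k \<zeta> (u(k := v)) l \<omega> + c *\<^sub>R hom_state M w p k z l \<omega>"
      unfolding vc_def by (rule step.IH) (use l in simp)
    have "AE \<omega> in M. cond_vec M w k (state M w p k \<zeta> (u(k := vc)) l) \<omega>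
        = cond_vec M w k (state M w p k \<zeta> (u(k := v)) l) \<omega>
          + c *\<^sub>R cond_vec M w k (hom_state M w p k z l) \<omega>"
      by (intro cond_vec_add_scaleR k IH L2F_mono[OF state_L2F l] L2F_mono[OF hom_state_L2F l]
          L2F_proc_upd assms vc l step)
    with IH show ?thesis
      unfolding vc_def[symmetric]
    proof eventually_elim
      case (elim \<omega>)
      then show ?case
        unfolding hom_state_Suc[OF \<open>k < l\<close>] state_Suc[OF step(1)]
        using \<open>k < l\<close> by (simp add: matrix_vector_right_distrib matrix_vector_mult_scaleR algebra_simps)
    qed
  qed
qed

text \<open>Carries a pointwise convexity-defect identity over to conditional expectations:
  \<open>f1\<close> and \<open>f2\<close> are meant for the end points, \<open>f3\<close> for the
  intermediate point and \<open>f4\<close> for the quadratic remainder.\<close>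

lemma cond_real_linear:
  assumes "k \<le> N" "integrable M f1" "integrable M f2" "integrable M f3" "integrable M f4"
    and "AE \<omega> in M. a * f1 \<omega> + b * f2 \<omega> = f3 \<omega> + c * f4 \<omega>"
  shows "AE \<omega> in M. a * cond_real M w k f1 \<omega> + b * cond_real M w k f2 \<omega>
    = cond_real M w k f3 \<omega> + c * cond_real M w k f4 \<omega>"
proof -
  interpret F: sigma_finite_subalgebra M "filt M w k"
    by (rule sigma_finite_filt[OF assms(1)])
  have "AE \<omega> in M. cond_real M w k (\<lambda>\<omega>. a * f1 \<omega> + b * f2 \<omega>) \<omega>
      = cond_real M w k (\<lambda>\<omega>. f3 \<omega> + c * f4 \<omega>) \<omega>"
    using assms by (intro F.real_cond_exp_cong) auto
  moreover have "AE \<omega> in M. cond_real M w k (\<lambda>\<omega>. a * f1 \<omega> + b * f2 \<omega>) \<omega>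
      = cond_real M w k (\<lambda>\<omega>. a * f1 \<omega>) \<omega> + cond_real M w k (\<lambda>\<omega>. b * f2 \<omega>) \<omega>"
    using assms by (intro F.real_cond_exp_add) auto
  moreover have "AE \<omega> in M. cond_real M w k (\<lambda>\<omega>. f3 \<omega> + c * f4 \<omega>) \<omega>
      = cond_real M w k f3 \<omega> + cond_real M w k (\<lambda>\<omega>. c * f4 \<omega>) \<omega>"
    using assms by (intro F.real_cond_exp_add) auto
  moreover note F.real_cond_exp_cmult[OF assms(2), of a] F.real_cond_exp_cmult[OF assms(3), of b]
    F.real_cond_exp_cmult[OF assms(5), of c]
  ultimately show ?thesis
    by eventually_elim simp
qed

lemma cond_real_qform_F_meas:
  fixes X :: "'a \<Rightarrow> real ^ 'd::finite"
  assumes "k \<le> N" "X \<in> L2F M w k"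
  shows "AE \<omega> in M. cond_real M w k (\<lambda>\<omega>. qform S (X \<omega>)) \<omega> = qform S (X \<omega>)"
proof -
  interpret F: sigma_finite_subalgebra M "filt M w k"
    by (rule sigma_finite_filt[OF assms(1)])
  show ?thesis
    by (intro F.real_cond_exp_F_meas L2F_integrable_bilinear[OF assms assms(2)]
        L2F_bilinear_measurable[OF assms assms(2)])
qed

end

subsection \<open>Convexity defect of the cost\<close>

text \<open>Conditional means enter as independent arguments, which makes the defect of the stage
  cost an identity of vectors without any probability.\<close>

abbreviation running_cost ::
    "('n::finite, 'm::finite) lq_data \<Rightarrow> nat \<Rightarrow> nat \<Rightarrow> real ^ 'n \<Rightarrow> real ^ 'n \<Rightarrow> real ^ 'm \<Rightarrow> real ^ 'm \<Rightarrow> real" where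
  "running_cost p k l x mx u mu \<equiv>
     qform (mQ p k l) x + qform (mQ_bar p k l) mx + qform (mR p k l) u + qform (mR_bar p k l) mu
     + 2 * (vq p k l \<bullet> x) + 2 * (vrho p k l \<bullet> u)"

text \<open>The linear terms have no defect; each of the four quadratic forms contributes its
  own.\<close>

lemma running_cost_convexity_defect:
  "c * running_cost p k l (x + y) (mx + my) (u + z) (mu + mz) + (1 - c) * running_cost p k l x mx u mu
   = running_cost p k l (x + c *\<^sub>R y) (mx + c *\<^sub>R my) (u + c *\<^sub>R z) (mu + c *\<^sub>R mz)
     + c * (1 - c) * (qform (mQ p k l) y + qform (mQ_bar p k l) my
       + (qform (mR p k l) z + qform (mR_bar p k l) mz))"
  using qform_convexity_defect[where c=c and S="mQ p k l" and x=x and y=y]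
    qform_convexity_defect[where c=c and S="mQ_bar p k l" and x=mx and y=my]
    qform_convexity_defect[where c=c and S="mR p k l" and x=u and y=z]
    qform_convexity_defect[where c=c and S="mR_bar p k l" and x=mu and y=mz]
  by (simp add: inner_add_right algebra_simps)

context mds_noise
begin

lemma running_cost_integrable:
  fixes p :: "('n::finite, 'm::finite) lq_data"
  assumes "x \<in> L2F M w N" "mx \<in> L2F M w N" "u \<in> L2F M w N" "mu \<in> L2F M w N"
  shows "integrable M (\<lambda>\<omega>. running_cost p k l (x \<omega>) (mx \<omega>) (u \<omega>) (mu \<omega>))"
  by (intro Bochner_Integration.integrable_add integrable_mult_right
      L2F_integrable_bilinear[OF order_refl] L2F_integrable_inner[OF order_refl] L2F_const assms)

text \<open>Stage cost of the homogeneous system without the control weight, which enters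
  \<open>hom_cost\<close> only once, at time \<open>k\<close>.\<close>

definition "hom_running_cost p k v l \<omega> =
  qform (mQ p k l) (hom_state M w p k v l \<omega>)
  + qform (mQ_bar p k l) (cond_vec M w k (hom_state M w p k v l) \<omega>)"

lemma hom_running_cost_integrable:
  assumes "l \<le> N" "k \<le> N" "v \<in> L2F M w k"
  shows "integrable M (hom_running_cost p k v l)"
proof -
  have Y: "hom_state M w p k v l \<in> L2F M w N"
    using L2F_mono[OF hom_state_L2F[OF assms] assms(1)] .
  have m: "cond_vec M w k (hom_state M w p k v l) \<in> L2F M w N"
    by (rule L2F_mono[OF L2F_cond_vec[OF assms(2) Y] assms(2)])
  show ?thesis
    unfolding hom_running_cost_def
    by (intro Bochner_Integration.integrable_add L2F_integrable_bilinear[OF order_refl] Y m)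
qed

text \<open>The affine part of the cost in the control at time \<open>k\<close> cancels here and is never named.\<close>

lemma cost_convexity_defect:
  fixes p :: "('n::finite, 'm::finite) lq_data"
  assumes "k < N" "\<zeta> \<in> L2F M w k" "u \<in> L2F_proc M w N (Suc k)"
    "v \<in> L2F M w k" "z \<in> L2F M w k"
  shows "AE \<omega> in M. c * cost M w N p k \<zeta> (u(k := (\<lambda>\<omega>. v \<omega> + z \<omega>))) \<omega>
      + (1 - c) * cost M w N p k \<zeta> (u(k := v)) \<omega>
    = cost M w N p k \<zeta> (u(k := (\<lambda>\<omega>. v \<omega> + c *\<^sub>R z \<omega>))) \<omega> + c * (1 - c) * hom_cost M w N p k z \<omega>"
proof -
  have k: "k \<le> N" "k \<le> N" using assms by auto
  \<comment> \<open>One family covers the three controls of the identity, at \<open>d = 0\<close>,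
    \<open>d = 1\<close> and \<open>d = c\<close>.\<close>
  define U where "U d = u(k := (\<lambda>\<omega>. v \<omega> + d *\<^sub>R z \<omega>))" for d :: real
  define X where "X d = state M w p k \<zeta> (U d)" for d
  define Y where "Y = hom_state M w p k z"
  define r where "r d l \<omega> = running_cost p k l (X d l \<omega>) (cond_vec M w k (X d l) \<omega>)
      (U d l \<omega>) (cond_vec M w k (U d l) \<omega>)" for d l \<omega>
  define h where "h = hom_running_cost p k z"
  \<comment> \<open>The control is perturbed at time \<open>k\<close> only; summation over
    \<open>l\<close> turns this into the single \<open>calR\<close> term of
    \<open>hom_cost\<close>.\<close>
  define q where "q l \<omega> = (if l = k then qform (calR p k k) (z \<omega>) else 0)" for l :: nat and \<omega>
  have U0: "U 0 = u(k := v)" and U1: "U 1 = u(k := (\<lambda>\<omega>. v \<omega> + z \<omega>))"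
    by (simp_all add: U_def)
  have Uproc: "U d \<in> L2F_proc M w N k" for d
    unfolding U_def by (intro L2F_proc_upd assms L2F_add k L2F_scaleR)
  have UL: "U d l \<in> L2F M w N" if "l \<in> {k..<N}" for d l
    using Uproc[of d] that L2F_mono[of "U d l" l N] by (auto simp: L2F_proc_def)
  have XL: "X d l \<in> L2F M w N" if "l \<in> {k..N}" for d l
    using that L2F_mono[OF state_L2F[OF _ _ assms(2) Uproc]] by (auto simp: X_def)
  have YL: "Y l \<in> L2F M w N" if "l \<in> {k..N}" for l
    using that L2F_mono[OF hom_state_L2F[OF _ k(1) assms(5)]] by (auto simp: Y_def)
  have cL: "cond_vec M w k V \<in> L2F M w N" if "V \<in> L2F M w N" for V :: "'a \<Rightarrow> real ^ 'd::finite"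
    by (rule L2F_mono[OF L2F_cond_vec[OF k(1) that] k(1)])
  have X: "AE \<omega> in M. X d l \<omega> = X 0 l \<omega> + d *\<^sub>R Y l \<omega>" if "l \<in> {k..N}" for d l
    using that state_perturbation[OF assms(1-5), of l p d] by (simp add: X_def Y_def U0) (simp add: U_def)
  have mX: "AE \<omega> in M. cond_vec M w k (X d l) \<omega>
      = cond_vec M w k (X 0 l) \<omega> + d *\<^sub>R cond_vec M w k (Y l) \<omega>" if "l \<in> {k..N}" for d l
    by (intro cond_vec_add_scaleR k X XL YL that)
  have pointwise: "AE \<omega> in M. c * r 1 l \<omega> + (1 - c) * r 0 l \<omega>
      = r c l \<omega> + c * (1 - c) * (h l \<omega> + q l \<omega>)" if l: "l \<in> {k..<N}" for l
  proof -
    have l': "l \<in> {k..N}" using l by simp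
    have "AE \<omega> in M. U d l \<omega> = U 0 l \<omega> + d *\<^sub>R (if l = k then z \<omega> else 0)" for d
      by (simp add: U_def)
    moreover have "AE \<omega> in M. cond_vec M w k (U d l) \<omega>
        = cond_vec M w k (U 0 l) \<omega> + d *\<^sub>R (if l = k then z \<omega> else 0)" for d
    \<comment> \<open>At time \<open>k\<close> the perturbed control is its own conditional mean; at
      later times the control is the same for every \<open>d\<close>.\<close>
    proof (cases "l = k")
      case True
      have "U d k \<in> L2F M w k" for d
        using Uproc[of d] assms(1) by (auto simp: L2F_proc_def)
      from cond_vec_F_meas[OF k(1) this[of d]] cond_vec_F_meas[OF k(1) this[of 0]]
      show ?thesis
        unfolding True by eventually_elim (simp add: U_def)
    qed (simp add: U_def)
    \<comment> \<open>The exceptional null sets are joined over the two values of \<open>d\<close>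
      that occur; over all real \<open>d\<close> their union need not be null.\<close>
    ultimately have "AE \<omega> in M. \<forall>d\<in>{1, c}. U d l \<omega> = U 0 l \<omega> + d *\<^sub>R (if l = k then z \<omega> else 0)
      \<and> cond_vec M w k (U d l) \<omega> = cond_vec M w k (U 0 l) \<omega> + d *\<^sub>R (if l = k then z \<omega> else 0)
      \<and> X d l \<omega> = X 0 l \<omega> + d *\<^sub>R Y l \<omega>
      \<and> cond_vec M w k (X d l) \<omega> = cond_vec M w k (X 0 l) \<omega> + d *\<^sub>R cond_vec M w k (Y l) \<omega>"
      using X[OF l'] mX[OF l'] by (intro eventually_ball_finite ballI AE_conjI) auto
    then show ?thesis
    proof eventually_elim
      case (elim \<omega>)
      show ?case
        using elim running_cost_convexity_defect[where p=p and k=k and l=l and c=c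
            and x="X 0 l \<omega>" and y="Y l \<omega>"
            and mx="cond_vec M w k (X 0 l) \<omega>" and my="cond_vec M w k (Y l) \<omega>"
            and u="U 0 l \<omega>" and z="if l = k then z \<omega> else 0"
            and mu="cond_vec M w k (U 0 l) \<omega>" and mz="if l = k then z \<omega> else 0"]
        unfolding r_def h_def q_def hom_running_cost_def Y_def[symmetric]
        by (simp add: qform_add_matrix split: if_splits)
    qed
  qed
  have r_int: "integrable M (r d l)" if "l \<in> {k..<N}" for d l
    unfolding r_def using that by (intro running_cost_integrable UL XL cL) auto
  have h_int: "integrable M (h l)" if "l \<in> {k..<N}" for l
    unfolding h_def using that by (intro hom_running_cost_integrable k assms) auto
  have q_int: "integrable M (q l)" for l
    unfolding q_def using L2F_integrable_bilinear[OF k(1) assms(5,5)] by (cases "l = k") simp_all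
  have q_cond: "AE \<omega> in M. cond_real M w k (q l) \<omega> = q l \<omega>" for l
  proof (rule sigma_finite_subalgebra.real_cond_exp_F_meas[OF sigma_finite_filt[OF k(1)] q_int])
    show "q l \<in> borel_measurable (filt M w k)"
      unfolding q_def using L2F_bilinear_measurable[OF k(1) assms(5,5)] by (cases "l = k") simp_all
  qed
  have running: "AE \<omega> in M. \<forall>l\<in>{k..<N}. c * cond_real M w k (r 1 l) \<omega> + (1 - c) * cond_real M w k (r 0 l) \<omega>
      = cond_real M w k (r c l) \<omega> + c * (1 - c) * (cond_real M w k (h l) \<omega> + q l \<omega>)"
  proof (intro eventually_ball_finite ballI)
    fix l assume l: "l \<in> {k..<N}"
    have "AE \<omega> in M. cond_real M w k (\<lambda>\<omega>. h l \<omega> + q l \<omega>) \<omega>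
        = cond_real M w k (h l) \<omega> + cond_real M w k (q l) \<omega>"
      by (intro sigma_finite_subalgebra.real_cond_exp_add[OF sigma_finite_filt[OF k(1)]] h_int q_int l)
    with q_cond[of l]
      cond_real_linear[OF k(1) r_int[OF l] r_int[OF l] r_int[OF l]
        Bochner_Integration.integrable_add[OF h_int[OF l] q_int[of l]] pointwise[OF l]]
    show "AE \<omega> in M. c * cond_real M w k (r 1 l) \<omega> + (1 - c) * cond_real M w k (r 0 l) \<omega>
      = cond_real M w k (r c l) \<omega> + c * (1 - c) * (cond_real M w k (h l) \<omega> + q l \<omega>)"
      by eventually_elim simp
  qed simp
  have N: "N \<in> {k..N}" using k by simp
  have XNd: "AE \<omega> in M. \<forall>d\<in>{1, c}. X d N \<omega> = X 0 N \<omega> + d *\<^sub>R Y N \<omega>"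
    using X[OF N] by (intro eventually_ball_finite ballI) auto
  have terminal: "AE \<omega> in M. c * cond_real M w k (\<lambda>\<omega>. qform (mG p k) (X 1 N \<omega>)) \<omega>
      + (1 - c) * cond_real M w k (\<lambda>\<omega>. qform (mG p k) (X 0 N \<omega>)) \<omega>
      = cond_real M w k (\<lambda>\<omega>. qform (mG p k) (X c N \<omega>)) \<omega>
        + c * (1 - c) * cond_real M w k (\<lambda>\<omega>. qform (mG p k) (Y N \<omega>)) \<omega>"
  proof (intro cond_real_linear k L2F_integrable_bilinear[OF order_refl] XL[OF N] YL[OF N])
    show "AE \<omega> in M. c * qform (mG p k) (X 1 N \<omega>) + (1 - c) * qform (mG p k) (X 0 N \<omega>)
        = qform (mG p k) (X c N \<omega>) + c * (1 - c) * qform (mG p k) (Y N \<omega>)"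
      using XNd by eventually_elim (simp add: qform_convexity_defect)
  qed
  \<comment> \<open>The linear terminal cost has no defect; the summand with coefficient 0 brings it
    into the form of \<open>cond_real_linear\<close>.\<close>
  have terminal_linear: "AE \<omega> in M. c * cond_real M w k (\<lambda>\<omega>. vg p k \<bullet> X 1 N \<omega>) \<omega>
      + (1 - c) * cond_real M w k (\<lambda>\<omega>. vg p k \<bullet> X 0 N \<omega>) \<omega>
      = cond_real M w k (\<lambda>\<omega>. vg p k \<bullet> X c N \<omega>) \<omega> + 0 * cond_real M w k (\<lambda>\<omega>. vg p k \<bullet> Y N \<omega>) \<omega>"
  proof (intro cond_real_linear k L2F_integrable_inner[OF order_refl] XL[OF N] YL[OF N] L2F_const)
    show "AE \<omega> in M. c * (vg p k \<bullet> X 1 N \<omega>) + (1 - c) * (vg p k \<bullet> X 0 N \<omega>)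
        = vg p k \<bullet> X c N \<omega> + 0 * (vg p k \<bullet> Y N \<omega>)"
      using XNd by eventually_elim (simp add: inner_add_right algebra_simps)
  qed
  have cost_U: "cost M w N p k \<zeta> (U d) \<omega> = (\<Sum>l=k..<N. cond_real M w k (r d l) \<omega>)
      + cond_real M w k (\<lambda>\<omega>. qform (mG p k) (X d N \<omega>)) \<omega>
      + qform (mG_bar p k) (cond_vec M w k (X d N) \<omega>)
      + 2 * cond_real M w k (\<lambda>\<omega>. vg p k \<bullet> X d N \<omega>) \<omega>" for d \<omega>
    by (simp add: cost_def Let_def X_def r_def[abs_def])
  have hom: "hom_cost M w N p k z \<omega> = (\<Sum>l=k..<N. cond_real M w k (h l) \<omega>)
      + qform (calR p k k) (z \<omega>) + cond_real M w k (\<lambda>\<omega>. qform (mG p k) (Y N \<omega>)) \<omega>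
      + qform (mG_bar p k) (cond_vec M w k (Y N) \<omega>)" for \<omega>
    by (simp add: hom_cost_def Let_def Y_def h_def hom_running_cost_def[abs_def])
  have "AE \<omega> in M. c * cost M w N p k \<zeta> (U 1) \<omega> + (1 - c) * cost M w N p k \<zeta> (U 0) \<omega>
    = cost M w N p k \<zeta> (U c) \<omega> + c * (1 - c) * hom_cost M w N p k z \<omega>"
    using running terminal terminal_linear mX[OF N, of 1] mX[OF N, of c]
  proof eventually_elim
    case (elim \<omega>)
    have "c * (\<Sum>l=k..<N. cond_real M w k (r 1 l) \<omega>) + (1 - c) * (\<Sum>l=k..<N. cond_real M w k (r 0 l) \<omega>)
        = (\<Sum>l=k..<N. cond_real M w k (r c l) \<omega> + c * (1 - c) * (cond_real M w k (h l) \<omega> + q l \<omega>))"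
      unfolding sum_distrib_left sum.distrib[symmetric] by (rule sum.cong) (use elim(1) in auto)
    also have "\<dots> = (\<Sum>l=k..<N. cond_real M w k (r c l) \<omega>)
        + c * (1 - c) * ((\<Sum>l=k..<N. cond_real M w k (h l) \<omega>) + (\<Sum>l=k..<N. q l \<omega>))"
      by (simp only: sum.distrib sum_distrib_left distrib_left)
    also have "(\<Sum>l=k..<N. q l \<omega>) = qform (calR p k k) (z \<omega>)"
      using assms(1) by (simp add: q_def)
    finally have 1: "c * (\<Sum>l=k..<N. cond_real M w k (r 1 l) \<omega>)
        + (1 - c) * (\<Sum>l=k..<N. cond_real M w k (r 0 l) \<omega>)
        = (\<Sum>l=k..<N. cond_real M w k (r c l) \<omega>)
        + c * (1 - c) * ((\<Sum>l=k..<N. cond_real M w k (h l) \<omega>) + qform (calR p k k) (z \<omega>))" .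
    have 2: "c * qform (mG_bar p k) (cond_vec M w k (X 1 N) \<omega>)
        + (1 - c) * qform (mG_bar p k) (cond_vec M w k (X 0 N) \<omega>)
        = qform (mG_bar p k) (cond_vec M w k (X c N) \<omega>)
          + c * (1 - c) * qform (mG_bar p k) (cond_vec M w k (Y N) \<omega>)"
      using elim(4,5) by (simp add: qform_convexity_defect)
    show ?case
      unfolding cost_U hom distrib_left using 1 2 elim(2,3) unfolding distrib_left by linarith
  qed
  then show ?thesis
    unfolding U0 U1 by (simp add: U_def)
qed

end

subsection \<open>Riccati recursion\<close>

lemma transpose_sum_symmetric:
  assumes "transpose S = S" "transpose T = T"
  shows "transpose (S + T) = S + T"
  using assms by (simp add: transpose_def vec_eq_iff)

lemma transpose_conj:
  fixes S :: "real ^ 'e::finite ^ 'e" and A :: "real ^ 'd::finite ^ 'e"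
  assumes "transpose S = S"
  shows "transpose (transpose A ** S ** A) = transpose A ** S ** A"
  using assms by (simp add: matrix_transpose_mul matrix_mul_assoc)

lemma ric_P_rec:
  assumes "l < N"
  shows "ric_P N p k l = mQ p k l + transpose (mA p k l) ** ric_P N p k (Suc l) ** mA p k l
    + transpose (mC p k l) ** ric_P N p k (Suc l) ** mC p k l"
  using assms by (subst ric_P.simps) simp

lemma ric_calP_rec:
  assumes "l < N"
  shows "ric_calP N p k l = calQ p k l + transpose (calA p k l) ** ric_calP N p k (Suc l) ** calA p k l
    + transpose (calC p k l) ** ric_P N p k (Suc l) ** calC p k l"
  using assms by (subst ric_calP.simps) simp

text \<open>Backward induction from the terminal time. It supplies the symmetry that
  \<open>psd\<close> demands of the matrix in condition (ii).\<close>

lemma ric_symmetric: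
  assumes "symmetric_data N p" "k < N" "k \<le> l" "l \<le> N"
  shows "transpose (ric_P N p k l) = ric_P N p k l \<and> transpose (ric_calP N p k l) = ric_calP N p k l"
  using assms(4,3)
proof (induction l rule: inc_induct)
  case base
  then show ?case
    using assms(1,2)
    by (simp add: ric_P.simps ric_calP.simps symmetric_data_def transpose_sum_symmetric)
next
  case (step l)
  then have IH: "transpose (ric_P N p k (Suc l)) = ric_P N p k (Suc l)"
      "transpose (ric_calP N p k (Suc l)) = ric_calP N p k (Suc l)"
    and Q: "transpose (mQ p k l) = mQ p k l" "transpose (mQ_bar p k l) = mQ_bar p k l"
    using assms(1,2) by (auto simp: symmetric_data_def)
  show ?case
    unfolding ric_P_rec[OF step(2)] ric_calP_rec[OF step(2)]
    by (intro conjI transpose_sum_symmetric transpose_conj IH Q)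
qed

text \<open>The matrix of condition (ii); \<open>hom_cost\<close> turns out to be its quadratic form
  in the control, almost surely.\<close>

definition control_weight :: "nat \<Rightarrow> ('n::finite, 'm::finite) lq_data \<Rightarrow> nat \<Rightarrow> real ^ 'm ^ 'm" where
  "control_weight N p k = calR p k k
     + transpose (calB p k k) ** ric_calP N p k (Suc k) ** calB p k k
     + transpose (calD p k k) ** ric_P N p k (Suc k) ** calD p k k"

lemma control_weight_symmetric:
  assumes "symmetric_data N p" "k < N"
  shows "transpose (control_weight N p k) = control_weight N p k"
proof -
  have "transpose (mR p k k) = mR p k k" "transpose (mR_bar p k k) = mR_bar p k k"
    using assms by (auto simp: symmetric_data_def)
  then show ?thesis
    unfolding control_weight_def using assms ric_symmetric[OF assms, of "Suc k"]
    by (intro transpose_sum_symmetric transpose_conj) simp_all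
qed

context mds_noise
begin

section \<open>Telescoping the homogeneous cost\<close>

lemma cond_vec_add_noise:
  fixes a b :: "'a \<Rightarrow> real ^ 'd::finite"
  assumes "k \<le> l" "l < N" "a \<in> L2F M w l" "b \<in> L2F M w l"
  shows "AE \<omega> in M. cond_vec M w k (\<lambda>\<omega>. a \<omega> + w l \<omega> *\<^sub>R b \<omega>) \<omega> = cond_vec M w k a \<omega>"
proof -
  have "k \<le> N" "a \<in> L2F M w N" "(\<lambda>\<omega>. w l \<omega> *\<^sub>R b \<omega>) \<in> L2F M w N"
    using assms L2F_mono[OF assms(3), of N] L2F_mono[OF L2F_noise[OF assms(2,4)], of N] by auto
  from cond_vec_add[OF this] cond_vec_noise[OF assms(1,2,4)] show ?thesis
    by eventually_elim simp
qed

text \<open>Conditioning a conditional mean again leaves it unchanged, so plain and barred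
  coefficients add up. This is how \<open>calA\<close> governs the evolution of the mean.\<close>

lemma cond_vec_mean:
  fixes Z :: "'a \<Rightarrow> real ^ 'd::finite" and E F :: "real ^ 'd ^ 'e::finite"
  assumes "k \<le> N" "Z \<in> L2F M w N"
  shows "AE \<omega> in M. cond_vec M w k (\<lambda>\<omega>. E *v Z \<omega> + F *v cond_vec M w k Z \<omega>) \<omega>
    = (E + F) *v cond_vec M w k Z \<omega>"
proof -
  have m: "(\<lambda>\<omega>. F *v cond_vec M w k Z \<omega>) \<in> L2F M w k"
    by (intro L2F_matrix L2F_cond_vec assms)
  show ?thesis
    using cond_vec_add[OF assms(1) L2F_matrix[OF order_refl assms(2), of E] L2F_mono[OF m assms(1)]]
      cond_vec_matrix[OF assms, of E] cond_vec_F_meas[OF assms(1) m]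
    by eventually_elim (simp add: matrix_vector_mult_add_rdistrib)
qed

text \<open>The conditional cost-to-go of the homogeneous system: \<open>ric_P\<close> weighs the fluctuation
  \<open>Y\<^sub>l - E\<^sub>k Y\<^sub>l\<close> and \<open>ric_calP\<close> the mean \<open>E\<^sub>k Y\<^sub>l\<close>; expanding the fluctuation gives this form.\<close>

definition "cost_to_go p k v l \<omega> =
  cond_real M w k (\<lambda>\<omega>. qform (ric_P N p k l) (hom_state M w p k v l \<omega>)) \<omega>
  + qform (ric_calP N p k l - ric_P N p k l) (cond_vec M w k (hom_state M w p k v l) \<omega>)"

text \<open>With the noise averaged out, the form at the next state splits into a drift and a
  diffusion part. The mean of the next state sees the drift only, which is why
  \<open>ric_calP\<close> recurs through \<open>calA\<close> but takes \<open>ric_P\<close> with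
  \<open>calC\<close>.\<close>

lemma cost_to_go_step:
  fixes p :: "('n::finite, 'm::finite) lq_data"
  assumes "k < l" "l < N" "v \<in> L2F M w k"
  shows "AE \<omega> in M. cost_to_go p k v l \<omega>
    = cond_real M w k (hom_running_cost p k v l) \<omega> + cost_to_go p k v (Suc l) \<omega>"
proof -
  have k: "k \<le> N" and kl: "k \<le> l" and l: "l \<le> N" using assms by auto
  interpret F: sigma_finite_subalgebra M "filt M w k"
    by (rule sigma_finite_filt[OF k])
  define Y where "Y = hom_state M w p k v l"
  define m where "m = cond_vec M w k Y"
  let ?P = "ric_P N p k (Suc l)" and ?cP = "ric_calP N p k (Suc l)"
  have Y: "Y \<in> L2F M w l"
    unfolding Y_def by (rule hom_state_L2F[OF l k assms(3)])
  have YN: "Y \<in> L2F M w N"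
    by (rule L2F_mono[OF Y l])
  have mk: "m \<in> L2F M w k"
    unfolding m_def by (rule L2F_cond_vec[OF k YN])
  have m: "m \<in> L2F M w l"
    by (rule L2F_mono[OF mk kl])
  define a where "a \<omega> = mA p k l *v Y \<omega> + mA_bar p k l *v m \<omega>" for \<omega>
  define b where "b \<omega> = mC p k l *v Y \<omega> + mC_bar p k l *v m \<omega>" for \<omega>
  have a: "a \<in> L2F M w l" and b: "b \<in> L2F M w l"
    unfolding a_def[abs_def] b_def[abs_def] by (intro L2F_add L2F_matrix l Y m)+
  have Suc: "hom_state M w p k v (Suc l) = (\<lambda>\<omega>. a \<omega> + w l \<omega> *\<^sub>R b \<omega>)"
    unfolding hom_state_Suc[OF assms(1)] a_def b_def Y_def m_def ..
  have int: "integrable M (\<lambda>\<omega>. qform S (E *v Y \<omega>))"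
    for S :: "real ^ 'n ^ 'n" and E :: "real ^ 'n ^ 'n"
    by (intro L2F_integrable_bilinear[OF l] L2F_matrix l Y)
  have intQ: "integrable M (\<lambda>\<omega>. qform (mQ p k l) (Y \<omega>))"
    by (intro L2F_integrable_bilinear[OF l] Y)
  have intm: "integrable M (\<lambda>\<omega>. qform (mQ_bar p k l) (m \<omega>))"
    by (intro L2F_integrable_bilinear[OF l] m)
  have now: "AE \<omega> in M. cond_real M w k (\<lambda>\<omega>. qform (ric_P N p k l) (Y \<omega>)) \<omega>
      = cond_real M w k (\<lambda>\<omega>. qform (mQ p k l) (Y \<omega>)) \<omega>
      + (cond_real M w k (\<lambda>\<omega>. qform ?P (mA p k l *v Y \<omega>)) \<omega>
      + cond_real M w k (\<lambda>\<omega>. qform ?P (mC p k l *v Y \<omega>)) \<omega>)"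
    unfolding ric_P_rec[OF assms(2)] qform_add_matrix qform_matrix_conj add.assoc
    using F.real_cond_exp_add[OF intQ Bochner_Integration.integrable_add[
          OF int[of "mA p k l" ?P] int[of "mC p k l" ?P]]]
      F.real_cond_exp_add[OF int[of "mA p k l" ?P] int[of "mC p k l" ?P]]
    by eventually_elim simp
  have run: "AE \<omega> in M. cond_real M w k (hom_running_cost p k v l) \<omega>
      = cond_real M w k (\<lambda>\<omega>. qform (mQ p k l) (Y \<omega>)) \<omega> + qform (mQ_bar p k l) (m \<omega>)"
    using F.real_cond_exp_add[OF intQ intm] cond_real_qform_F_meas[OF k mk, of "mQ_bar p k l"]
    unfolding hom_running_cost_def[abs_def] Y_def[symmetric] m_def[symmetric]
    by eventually_elim simp
  have A: "AE \<omega> in M. cond_real M w k (\<lambda>\<omega>. qform ?P (a \<omega>)) \<omega>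
      = cond_real M w k (\<lambda>\<omega>. qform ?P (mA p k l *v Y \<omega>)) \<omega>
      + qform ?P (calA p k l *v m \<omega>) - qform ?P (mA p k l *v m \<omega>)"
    unfolding a_def m_def by (rule cond_real_qform_mean[OF k YN])
  have C: "AE \<omega> in M. cond_real M w k (\<lambda>\<omega>. qform ?P (b \<omega>)) \<omega>
      = cond_real M w k (\<lambda>\<omega>. qform ?P (mC p k l *v Y \<omega>)) \<omega>
      + qform ?P (calC p k l *v m \<omega>) - qform ?P (mC p k l *v m \<omega>)"
    unfolding b_def m_def by (rule cond_real_qform_mean[OF k YN])
  have mean: "AE \<omega> in M. cond_vec M w k a \<omega> = calA p k l *v m \<omega>"
    unfolding a_def[abs_def] m_def by (rule cond_vec_mean[OF k YN])
  show ?thesis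
    unfolding cost_to_go_def Suc Y_def[symmetric] m_def[symmetric]
    using now run A C mean cond_vec_add_noise[OF kl assms(2) a b]
      cond_real_qform_noise[OF kl assms(2) a b, of ?P]
  proof eventually_elim
    case (elim \<omega>)
    \<comment> \<open>The difference of the two Riccati recursions: the subtracted forms are exactly
      those that \<open>cond_real_qform_mean\<close> produced for drift and diffusion.\<close>
    have "qform (ric_calP N p k l - ric_P N p k l) (m \<omega>) = qform (mQ_bar p k l) (m \<omega>)
        + qform ?cP (calA p k l *v m \<omega>) + qform ?P (calC p k l *v m \<omega>)
        - qform ?P (mA p k l *v m \<omega>) - qform ?P (mC p k l *v m \<omega>)"
      unfolding ric_P_rec[OF assms(2)] ric_calP_rec[OF assms(2)] qform_diff_matrix
        qform_add_matrix qform_matrix_conj by simp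
    with elim show ?case
      by (simp add: qform_diff_matrix)
  qed
qed

text \<open>The state at \<open>Suc k\<close> has drift \<open>calB v\<close> and diffusion
  \<open>calD v\<close>, both known at time \<open>k\<close>. The \<open>ric_P\<close> form at the
  drift cancels against the mean correction, leaving \<open>ric_calP\<close> there and
  \<open>ric_P\<close> at the diffusion.\<close>

lemma cost_to_go_first:
  assumes "k < N" "v \<in> L2F M w k"
  shows "AE \<omega> in M. cost_to_go p k v (Suc k) \<omega> + qform (calR p k k) (v \<omega>)
    = qform (control_weight N p k) (v \<omega>)"
proof -
  have k: "k \<le> N" using assms by simp
  have B: "(\<lambda>\<omega>. calB p k k *v v \<omega>) \<in> L2F M w k" and D: "(\<lambda>\<omega>. calD p k k *v v \<omega>) \<in> L2F M w k"
    by (intro L2F_matrix k assms)+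
  show ?thesis
    unfolding cost_to_go_def
    using cond_real_qform_noise[OF order_refl assms(1) B D, of "ric_P N p k (Suc k)"]
      cond_vec_add_noise[OF order_refl assms(1) B D] cond_vec_F_meas[OF k B]
      cond_real_qform_F_meas[OF k B, of "ric_P N p k (Suc k)"]
      cond_real_qform_F_meas[OF k D, of "ric_P N p k (Suc k)"]
    by eventually_elim
      (simp add: control_weight_def qform_add_matrix qform_diff_matrix qform_matrix_conj)
qed

text \<open>Telescopes \<open>cost_to_go_step\<close> backward from \<open>N\<close>. The strict
  bound \<open>k < l\<close> leaves out the step from \<open>k\<close>, where the control enters and
  the recursion is a different one.\<close>

lemma cost_to_go_sum:
  fixes p :: "('n::finite, 'm::finite) lq_data"
  assumes "k < l" "l \<le> N" "v \<in> L2F M w k"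
  shows "AE \<omega> in M. cost_to_go p k v l \<omega>
    = (\<Sum>j=l..<N. cond_real M w k (hom_running_cost p k v j) \<omega>) + cost_to_go p k v N \<omega>"
  using assms(2,1)
proof (induction l rule: inc_induct)
  case base
  then show ?case by simp
next
  case (step l)
  have "k < Suc l"
    using step.prems by simp
  from step.IH[OF this] cost_to_go_step[OF step.prems step.hyps(2) assms(3), of p] show ?case
    by eventually_elim (simp add: sum.atLeast_Suc_lessThan step.hyps(2))
qed

lemma hom_cost_eq_qform:
  fixes p :: "('n::finite, 'm::finite) lq_data"
  assumes "k < N" "v \<in> L2F M w k"
  shows "AE \<omega> in M. hom_cost M w N p k v \<omega> = qform (control_weight N p k) (v \<omega>)"
proof -
  have k: "k \<le> N" using assms by simp
  interpret F: sigma_finite_subalgebra M "filt M w k"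
    by (rule sigma_finite_filt[OF k])
  \<comment> \<open>The homogeneous state starts at zero, so the stage cost at time \<open>k\<close>
    vanishes almost surely.\<close>
  have "AE \<omega> in M. cond_vec M w k (hom_state M w p k v k) \<omega> = 0"
    using cond_vec_F_meas[OF k L2F_const, of "0 :: real ^ 'n"] by (simp add: hom_state_initial)
  then have "AE \<omega> in M. hom_running_cost p k v k \<omega> = 0"
    by eventually_elim (simp add: hom_running_cost_def hom_state_initial)
  then have "AE \<omega> in M. cond_real M w k (hom_running_cost p k v k) \<omega> = cond_real M w k (\<lambda>\<omega>. 0) \<omega>"
    using hom_running_cost_integrable[OF k k assms(2), of p] by (intro F.real_cond_exp_cong) auto
  moreover have "AE \<omega> in M. cond_real M w k (\<lambda>\<omega>. 0) \<omega> = 0"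
    by (rule F.real_cond_exp_F_meas) simp_all
  \<comment> \<open>The terminal values of \<open>ric_calP\<close> and \<open>ric_P\<close> differ
    by \<open>mG_bar\<close>, so the terminal cost is the cost-to-go at \<open>N\<close>.\<close>
  moreover have "AE \<omega> in M. hom_cost M w N p k v \<omega> = cond_real M w k (hom_running_cost p k v k) \<omega>
      + (\<Sum>l=Suc k..<N. cond_real M w k (hom_running_cost p k v l) \<omega>)
      + qform (calR p k k) (v \<omega>) + cost_to_go p k v N \<omega>"
    using assms(1)
    by (simp add: hom_cost_def Let_def hom_running_cost_def[abs_def] cost_to_go_def
        ric_P.simps[of N p k N] ric_calP.simps[of N p k N] sum.atLeast_Suc_lessThan)
  moreover have "AE \<omega> in M. cost_to_go p k v (Suc k) \<omega>
      = (\<Sum>l=Suc k..<N. cond_real M w k (hom_running_cost p k v l) \<omega>) + cost_to_go p k v N \<omega>"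
    using assms by (intro cost_to_go_sum) auto
  moreover note cost_to_go_first[OF assms, of p]
  ultimately show ?thesis
    by eventually_elim simp
qed

section \<open>Nonnegativity, positive semidefiniteness and convexity\<close>

lemma hom_cost_nonneg_iff_psd:
  fixes p :: "('n::finite, 'm::finite) lq_data"
  assumes "k < N" "symmetric_data N p"
  shows "(\<forall>v \<in> L2F M w k. AE \<omega> in M. 0 \<le> hom_cost M w N p k v \<omega>) \<longleftrightarrow> psd (control_weight N p k)"
proof
  assume nonneg: "\<forall>v \<in> L2F M w k. AE \<omega> in M. 0 \<le> hom_cost M w N p k v \<omega>"
  have "0 \<le> qform (control_weight N p k) x" for x
  proof -
    have "AE \<omega> in M. 0 \<le> hom_cost M w N p k (\<lambda>\<omega>. x) \<omega>"
      using nonneg L2F_const[of x k] by simp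
    with hom_cost_eq_qform[OF assms(1) L2F_const[of x k], of p]
    have "AE \<omega> in M. 0 \<le> qform (control_weight N p k) x"
      by eventually_elim simp
    \<comment> \<open>The inequality is independent of the sample point, and a probability space is
      not a null set.\<close>
    then show ?thesis
      by simp
  qed
  then show "psd (control_weight N p k)"
    using control_weight_symmetric[OF assms(2,1)] by (simp add: psd_def)
next
  assume "psd (control_weight N p k)"
  then have *: "0 \<le> qform (control_weight N p k) x" for x
    by (simp add: psd_def)
  show "\<forall>v \<in> L2F M w k. AE \<omega> in M. 0 \<le> hom_cost M w N p k v \<omega>"
  proof
    fix v :: "'a \<Rightarrow> real ^ 'm"
    assume "v \<in> L2F M w k"
    from hom_cost_eq_qform[OF assms(1) this, of p] show "AE \<omega> in M. 0 \<le> hom_cost M w N p k v \<omega>"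
      by eventually_elim (simp add: *)
  qed
qed

lemma pointwise_convex_at_if_hom_cost_nonneg:
  fixes p :: "('n::finite, 'm::finite) lq_data"
  assumes "k < N" "\<zeta> \<in> L2F M w k"
    and nonneg: "\<forall>v \<in> L2F M w k. AE \<omega> in M. 0 \<le> hom_cost M w N p k v \<omega>"
  shows "pointwise_convex_at M w N p k \<zeta>"
  unfolding pointwise_convex_at_def
proof (intro ballI)
  fix u :: "nat \<Rightarrow> 'a \<Rightarrow> real ^ 'm" and v1 v2 :: "'a \<Rightarrow> real ^ 'm" and c :: real
  assume u: "u \<in> L2F_proc M w N (Suc k)" and v1: "v1 \<in> L2F M w k" and v2: "v2 \<in> L2F M w k"
    and c: "c \<in> {0..1}"
  \<comment> \<open>The segment starts at \<open>v2\<close> with direction \<open>v1 - v2\<close>,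
    written as a sum to fit the closure lemmas for \<open>L2F\<close>.\<close>
  define z where "z \<omega> = v1 \<omega> + (-1) *\<^sub>R v2 \<omega>" for \<omega>
  have z: "z \<in> L2F M w k"
    unfolding z_def[abs_def] using assms(1) by (intro L2F_add L2F_scaleR v1 v2) simp
  have eq: "(\<lambda>\<omega>. v2 \<omega> + z \<omega>) = v1" "(\<lambda>\<omega>. v2 \<omega> + c *\<^sub>R z \<omega>) = (\<lambda>\<omega>. c *\<^sub>R v1 \<omega> + (1 - c) *\<^sub>R v2 \<omega>)"
    by (auto simp: z_def algebra_simps)
  have "AE \<omega> in M. 0 \<le> hom_cost M w N p k z \<omega>"
    using nonneg z by blast
  with cost_convexity_defect[OF assms(1,2) u v2 z, of c p]
  show "AE \<omega> in M. cost M w N p k \<zeta> (u(k := \<lambda>\<omega>. c *\<^sub>R v1 \<omega> + (1 - c) *\<^sub>R v2 \<omega>)) \<omega>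
      \<le> c * cost M w N p k \<zeta> (u(k := v1)) \<omega> + (1 - c) * cost M w N p k \<zeta> (u(k := v2)) \<omega>"
    unfolding eq
  proof eventually_elim
    case (elim \<omega>)
    have "0 \<le> c * (1 - c) * hom_cost M w N p k z \<omega>"
      using elim(2) c by simp
    with elim(1) show ?case by linarith
  qed
qed

text \<open>At \<open>c = 1/2\<close> the factor \<open>c * (1 - c)\<close> is strictly positive, so
  a single midpoint inequality decides the sign. Both convexity and equilibrium supply such an
  inequality.\<close>

lemma hom_cost_nonneg_if_midpoint_convex:
  fixes p :: "('n::finite, 'm::finite) lq_data"
  assumes "k < N" "\<zeta> \<in> L2F M w k" "u \<in> L2F_proc M w N (Suc k)" "v \<in> L2F M w k" "z \<in> L2F M w k"
    and "AE \<omega> in M. cost M w N p k \<zeta> (u(k := (\<lambda>\<omega>. v \<omega> + (1/2) *\<^sub>R z \<omega>))) \<omega>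
      \<le> 1/2 * cost M w N p k \<zeta> (u(k := (\<lambda>\<omega>. v \<omega> + z \<omega>))) \<omega> + 1/2 * cost M w N p k \<zeta> (u(k := v)) \<omega>"
  shows "AE \<omega> in M. 0 \<le> hom_cost M w N p k z \<omega>"
  using cost_convexity_defect[OF assms(1-5), of "1/2" p] assms(6)
  by eventually_elim simp

text \<open>The defect depends on the direction \<open>z\<close> alone, so the base control and all
  later controls are taken to be zero.\<close>

lemma hom_cost_nonneg_if_pointwise_convex_at:
  fixes p :: "('n::finite, 'm::finite) lq_data"
  assumes "k < N" "\<zeta> \<in> L2F M w k" "pointwise_convex_at M w N p k \<zeta>" "z \<in> L2F M w k"
  shows "AE \<omega> in M. 0 \<le> hom_cost M w N p k z \<omega>"
proof (rule hom_cost_nonneg_if_midpoint_convex[OF assms(1,2) _ L2F_const[of 0] assms(4)])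
  let ?u = "\<lambda>(_::nat) (_::'a). 0 :: real ^ 'm"
  show u: "?u \<in> L2F_proc M w N (Suc k)"
    by (simp add: L2F_proc_def L2F_const)
  note assms(3)[unfolded pointwise_convex_at_def, rule_format, OF u assms(4) L2F_const[of 0],
      of "1/2"]
  then show "AE \<omega> in M. cost M w N p k \<zeta> (?u(k := \<lambda>\<omega>. 0 + (1/2) *\<^sub>R z \<omega>)) \<omega>
      \<le> 1/2 * cost M w N p k \<zeta> (?u(k := \<lambda>\<omega>. 0 + z \<omega>)) \<omega> + 1/2 * cost M w N p k \<zeta> (?u(k := \<lambda>\<omega>. 0)) \<omega>"
    by simp
qed

text \<open>The equilibrium control \<open>u k\<close> is the midpoint of \<open>u k - z/2\<close> and \<open>u k + z/2\<close>, and neither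
  deviation improves on it.\<close>

lemma hom_cost_nonneg_if_equilibrium:
  fixes p :: "('n::finite, 'm::finite) lq_data"
  assumes "open_loop_equilibrium_pair M w N p t x X u" "k \<in> {t..<N}" "z \<in> L2F M w k"
  shows "AE \<omega> in M. 0 \<le> hom_cost M w N p k z \<omega>"
proof -
  have k: "k < N" "k \<le> N" using assms(2) by auto
  have X: "X k \<in> L2F M w k" and uk: "u k \<in> L2F M w k" and u: "u \<in> L2F_proc M w N (Suc k)"
    and opt: "\<And>v. v \<in> L2F M w k \<Longrightarrow>
      AE \<omega> in M. cost M w N p k (X k) u \<omega> \<le> cost M w N p k (X k) (u(k := v)) \<omega>"
    using assms(1,2) by (auto simp: open_loop_equilibrium_pair_def L2F_proc_def)
  define v where "v \<omega> = u k \<omega> + (-1/2) *\<^sub>R z \<omega>" for \<omega>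
  have v: "v \<in> L2F M w k"
    unfolding v_def[abs_def] by (intro L2F_add k uk L2F_scaleR assms)
  have vz: "(\<lambda>\<omega>. v \<omega> + z \<omega>) \<in> L2F M w k"
    by (intro L2F_add k v assms)
  have mid: "u(k := (\<lambda>\<omega>. v \<omega> + (1/2) *\<^sub>R z \<omega>)) = u"
    by (auto simp: v_def)
  show ?thesis
  proof (rule hom_cost_nonneg_if_midpoint_convex[OF k(1) X u v assms(3)])
    show "AE \<omega> in M. cost M w N p k (X k) (u(k := (\<lambda>\<omega>. v \<omega> + (1/2) *\<^sub>R z \<omega>))) \<omega>
      \<le> 1/2 * cost M w N p k (X k) (u(k := (\<lambda>\<omega>. v \<omega> + z \<omega>))) \<omega>
        + 1/2 * cost M w N p k (X k) (u(k := v)) \<omega>"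
      unfolding mid using opt[OF vz] opt[OF v] by eventually_elim linarith
  qed
qed

end

section \<open>Equivalence of the four conditions and the consequence for equilibria\<close>

theorem proposition2p5:
  fixes M :: "'a measure" and w :: "nat \<Rightarrow> 'a \<Rightarrow> real" and N :: nat
    and p :: "('n::finite, 'm::finite) lq_data"
  assumes "1 \<le> N" and "mds_noise M w N" and "symmetric_data N p"
  shows
    "(\<forall>k<N.
        ((\<forall>v \<in> L2F M w k. AE \<omega> in M. 0 \<le> hom_cost M w N p k v \<omega>)
           \<longleftrightarrow> psd (calR p k k
                + transpose (calB p k k) ** ric_calP N p k (Suc k) ** calB p k k
                + transpose (calD p k k) ** ric_P N p k (Suc k) ** calD p k k))
      \<and> (psd (calR p k k
                + transpose (calB p k k) ** ric_calP N p k (Suc k) ** calB p k k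
                + transpose (calD p k k) ** ric_P N p k (Suc k) ** calD p k k)
           \<longleftrightarrow> (\<exists>\<zeta> \<in> L2F M w k. pointwise_convex_at M w N p k \<zeta>))
      \<and> ((\<exists>\<zeta> \<in> L2F M w k. pointwise_convex_at M w N p k \<zeta>)
           \<longleftrightarrow> (\<forall>\<zeta> \<in> L2F M w k. pointwise_convex_at M w N p k \<zeta>)))
   \<and> (\<forall>t<N. \<forall>x \<in> L2F M w t.
        (\<exists>X u. open_loop_equilibrium_pair M w N p t x X u)
           \<longrightarrow> (\<forall>k\<in>{t..<N}. \<forall>\<zeta> \<in> L2F M w k. pointwise_convex_at M w N p k \<zeta>))"
proof -
  interpret mds_noise M w N
    by (rule assms(2))
  \<comment> \<open>The right-hand side is free of \<open>\<zeta>\<close>, so convexity holds at all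
    initial states or at none.\<close>
  have convex_iff: "pointwise_convex_at M w N p k \<zeta>
      \<longleftrightarrow> (\<forall>v \<in> L2F M w k. AE \<omega> in M. 0 \<le> hom_cost M w N p k v \<omega>)"
    if "k < N" "\<zeta> \<in> L2F M w k" for k \<zeta>
    using pointwise_convex_at_if_hom_cost_nonneg[OF that]
      hom_cost_nonneg_if_pointwise_convex_at[OF that] by blast
  \<comment> \<open>Passing from all initial states to some initial state requires one to exist; a
    constant vector serves.\<close>
  have L2F_nonempty: "\<exists>\<zeta> :: 'a \<Rightarrow> real ^ 'n. \<zeta> \<in> L2F M w k" for k
    using L2F_const by blast
  show ?thesis
  proof (intro conjI allI impI ballI)
    fix k
    assume k: "k < N"
    note psd_iff = hom_cost_nonneg_iff_psd[OF k assms(3), unfolded control_weight_def]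
    show "(\<forall>v \<in> L2F M w k. AE \<omega> in M. 0 \<le> hom_cost M w N p k v \<omega>) \<longleftrightarrow> psd (calR p k k
        + transpose (calB p k k) ** ric_calP N p k (Suc k) ** calB p k k
        + transpose (calD p k k) ** ric_P N p k (Suc k) ** calD p k k)"
      by (rule psd_iff)
    show "psd (calR p k k
        + transpose (calB p k k) ** ric_calP N p k (Suc k) ** calB p k k
        + transpose (calD p k k) ** ric_P N p k (Suc k) ** calD p k k)
        \<longleftrightarrow> (\<exists>\<zeta> \<in> L2F M w k. pointwise_convex_at M w N p k \<zeta>)"
      unfolding psd_iff[symmetric] using convex_iff[OF k] L2F_nonempty[of k] by blast
    show "(\<exists>\<zeta> \<in> L2F M w k. pointwise_convex_at M w N p k \<zeta>)
        \<longleftrightarrow> (\<forall>\<zeta> \<in> L2F M w k. pointwise_convex_at M w N p k \<zeta>)"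
      using convex_iff[OF k] L2F_nonempty[of k] by blast
  next
    fix t x k and \<zeta> :: "'a \<Rightarrow> real ^ 'n"
    assume "\<exists>X u. open_loop_equilibrium_pair M w N p t x X u" and k: "k \<in> {t..<N}"
      and \<zeta>: "\<zeta> \<in> L2F M w k"
    then obtain X u where eq: "open_loop_equilibrium_pair M w N p t x X u"
      by blast
    have "k < N"
      using k by simp
    then show "pointwise_convex_at M w N p k \<zeta>"
      using hom_cost_nonneg_if_equilibrium[OF eq k] \<zeta>
      by (intro pointwise_convex_at_if_hom_cost_nonneg ballI)
  qed
qed

end
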